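(* Let $p\in\mathbb N$. For $q\in X_p$, let $J$ be the Jacobi operator with perturbation $q$ and let $(\alpha_j^\pm)_{j=1}^p$ be the eigenvalues of the matrices $J^\pm$. Then the mapping $$X_p\to\mathcal E_{2p},\qquad q\mapsto \alpha^+\star\alpha^-=(\alpha_1^-,\alpha_1^+,\alpha_2^-,\alpha_2^+,\dots,\alpha_p^-,\alpha_p^+)$$ is a real analytic isomorphism between $X_p$ and $\mathcal E_{2p}$. Moreover, there is an algorithm to recover $q$ from the numbers $\{\alpha_j^\pm\}$.
   Context: $\mathbb N=\{1,2,\dots\}$. For real bounded sequences $(a_x)_{x\ge1}$, $(b_x)_{x\ge1}$ with $a_x>0$, the Jacobi operator $J$ on $\ell^2(\mathbb N)$ is $(Jf)_x=a_xf_{x+1}+b_xf_x+a_{x-1}f_{x-1}$, $x\ge1$, with $f_0=0$ formally. Its perturbation is $q=q(a,b)=(b_1,a_1-1,b_2,a_2-1,\dots)$. Put $$X_p=\{h\in\ell^\infty(\mathbb N)\ \text{real}:\ h_{2x}>-1\ \forall x\in\mathbb N,\ |h_{2p-1}|+|h_{2p}|\ne0,\ h_x=0\ \forall x>2p\},$$ identified with a subset of $\mathbb R^{2p}$ via the first $2p$ coordinates. $\mathcal E_{2p}$ is the set of strictly increasing sequences in $\mathbb R^{2p}$. $J_p$ is the $p\times p$ Jacobi matrix with diagonal $b_1,\dots,b_p$ and off-diagonal $a_1,\dots,a_{p-1}$. $J^\pm$ is obtained from $J_p$ by replacing the $(p,p)$ entry $b_p$ by $b_p\pm a_p^2$; its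 eigenvalues are labelled $\alpha_1^\pm<\dots<\alpha_p^\pm$, and they interlace: $\alpha^-_1<\alpha^+_1<\alpha^-_2<\alpha^+_2<\dots<\alpha^-_p<\alpha^+_p$.
   Formalization: The map on X_p is not onto E_{2p} (p=1: (-1,1) would need q=0). The formal claim: it is an isomorphism onto E_{2p} minus the data of perturbations with h_{2p-1}=h_{2p}=0, and onto all of E_{2p} once those are added to X_p. *)

theory Defs
  imports
    "Jordan_Normal_Form.Spectral_Radius"
    "HOL-Analysis.Infinite_Sum"
    "HOL-Analysis.Elementary_Metric_Spaces"
begin

(* Sequences (h_x), x = 1, 2, ..., are functions on nat whose unused coordinate 0 is pinned to 0.
   The space R^m is the set of those sequences that vanish outside {1..m}, so identifying finitely
   supported sequences with vectors is literal inclusion. *)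

definition Rvec :: "nat \<Rightarrow> (nat \<Rightarrow> real) set" where
  "Rvec m = {x. \<forall>i. i \<notin> {1..m} \<longrightarrow> x i = 0}"

section \<open>Real analytic maps between subsets of finite-dimensional spaces\<close>

definition multi_indices :: "nat \<Rightarrow> (nat \<Rightarrow> nat) set" where
  "multi_indices m = {\<nu>. \<forall>i. i \<notin> {1..m} \<longrightarrow> \<nu> i = 0}"

(* The sums are unconditional (has_sum), i.e. the power series converge absolutely.
   The clause y \<in> U makes U open in R^m. *)
definition real_analytic_map ::
    "nat \<Rightarrow> nat \<Rightarrow> ((nat \<Rightarrow> real) \<Rightarrow> (nat \<Rightarrow> real)) \<Rightarrow> (nat \<Rightarrow> real) set \<Rightarrow> bool" where
  "real_analytic_map m k f U \<longleftrightarrow>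
     U \<subseteq> Rvec m \<and> f ` U \<subseteq> Rvec k \<and>
     (\<forall>x\<in>U. \<forall>j\<in>{1..k}. \<exists>r>0. \<exists>c :: (nat \<Rightarrow> nat) \<Rightarrow> real.
        \<forall>y\<in>Rvec m. (\<forall>i\<in>{1..m}. \<bar>y i - x i\<bar> < r) \<longrightarrow>
          y \<in> U \<and>
          ((\<lambda>\<nu>. c \<nu> * (\<Prod>i=1..m. (y i - x i) ^ \<nu> i)) has_sum f y j) (multi_indices m))"

definition real_analytic_iso ::
    "nat \<Rightarrow> (nat \<Rightarrow> real) set \<Rightarrow> (nat \<Rightarrow> real) set \<Rightarrow> ((nat \<Rightarrow> real) \<Rightarrow> (nat \<Rightarrow> real)) \<Rightarrow> bool" where
  "real_analytic_iso m U V f \<longleftrightarrow>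
     bij_betw f U V \<and> real_analytic_map m m f U \<and> real_analytic_map m m (inv_into U f) V"

section \<open>Jacobi operators and their perturbations\<close>

definition jacobi_op ::
    "(nat \<Rightarrow> real) \<Rightarrow> (nat \<Rightarrow> real) \<Rightarrow> (nat \<Rightarrow> real) \<Rightarrow> (nat \<Rightarrow> real)" where
  "jacobi_op a b f x =
     (if x = 0 then 0
      else a x * f (x + 1) + b x * f x + (if x = 1 then 0 else a (x - 1) * f (x - 1)))"

definition perturbation :: "(nat \<Rightarrow> real) \<Rightarrow> (nat \<Rightarrow> real) \<Rightarrow> (nat \<Rightarrow> real)" where
  "perturbation a b x = (if x = 0 then 0 else if odd x then b ((x + 1) div 2) else a (x div 2) - 1)"

(* The coefficients of the Jacobi operator with perturbation q; see perturbation_eq_iff. *)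
definition coeff_a :: "(nat \<Rightarrow> real) \<Rightarrow> nat \<Rightarrow> real" where
  "coeff_a q x = q (2 * x) + 1"

definition coeff_b :: "(nat \<Rightarrow> real) \<Rightarrow> nat \<Rightarrow> real" where
  "coeff_b q x = q (2 * x - 1)"

lemma perturbation_eq_iff:
  assumes "q 0 = 0"
  shows "perturbation a b = q \<longleftrightarrow> (\<forall>x\<ge>1. a x = coeff_a q x \<and> b x = coeff_b q x)"
proof
  assume "perturbation a b = q"
  moreover have "perturbation a b (2 * x) = a x - 1" "perturbation a b (2 * x - 1) = b x"
    if "x \<ge> 1" for x
    using that by (cases x; simp add: perturbation_def)+
  ultimately show "\<forall>x\<ge>1. a x = coeff_a q x \<and> b x = coeff_b q x"
    by (auto simp: coeff_a_def coeff_b_def)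
next
  assume *: "\<forall>x\<ge>1. a x = coeff_a q x \<and> b x = coeff_b q x"
  show "perturbation a b = q"
  proof
    fix x
    show "perturbation a b x = q x"
    proof (cases "odd x")
      case True
      then obtain k where "x = 2 * k + 1" by (auto elim: oddE)
      then show ?thesis using * by (auto simp: perturbation_def coeff_b_def)
    next
      case False
      then obtain k where "x = 2 * k" by (auto elim: evenE)
      then show ?thesis using * assms by (cases "k = 0") (auto simp: perturbation_def coeff_a_def)
    qed
  qed
qed

section \<open>The spaces of perturbations and of spectral data\<close>

definition X_space :: "nat \<Rightarrow> (nat \<Rightarrow> real) set" where
  "X_space p = {h. bounded (range h) \<and> h 0 = 0 \<and> (\<forall>x\<ge>1. h (2 * x) > -1) \<and>
                   \<bar>h (2 * p - 1)\<bar> + \<bar>h (2 * p)\<bar> \<noteq> 0 \<and> (\<forall>x>2 * p. h x = 0)}"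

(* The perturbations that X_space p leaves out because the pair with indices 2p - 1, 2p vanishes,
   i.e. b_p = 0 and a_p = 1.  They too have spectral data in E_space (2 p): for p = 1, q = 0 gives
   (-1, 1).  The image of X_space p is therefore a proper subset of E_space (2 p). *)
definition X_degenerate :: "nat \<Rightarrow> (nat \<Rightarrow> real) set" where
  "X_degenerate p = {h. bounded (range h) \<and> h 0 = 0 \<and> (\<forall>x\<ge>1. h (2 * x) > -1) \<and>
                        \<bar>h (2 * p - 1)\<bar> + \<bar>h (2 * p)\<bar> = 0 \<and> (\<forall>x>2 * p. h x = 0)}"

definition E_space :: "nat \<Rightarrow> (nat \<Rightarrow> real) set" where
  "E_space m = {x \<in> Rvec m. strict_mono_on {1..m} x}"

section \<open>Jacobi matrices and their eigenvalues\<close>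

(* Matrix indices start at 0, sequence indices at 1. *)
definition jacobi_mat :: "(nat \<Rightarrow> real) \<Rightarrow> (nat \<Rightarrow> real) \<Rightarrow> nat \<Rightarrow> real mat" where
  "jacobi_mat a b p = mat p p (\<lambda>(i, j).
     if i = j then b (i + 1)
     else if j = i + 1 then a (i + 1)
     else if i = j + 1 then a (j + 1)
     else 0)"

lemma jacobi_mat_compression:
  assumes "i < p" "j < p"
  shows "jacobi_mat a b p $$ (i, j) = jacobi_op a b (\<lambda>x. if x = j + 1 then 1 else 0) (i + 1)"
  using assms by (auto simp: jacobi_mat_def jacobi_op_def)

definition jacobi_mat_plus :: "(nat \<Rightarrow> real) \<Rightarrow> (nat \<Rightarrow> real) \<Rightarrow> nat \<Rightarrow> real mat" where
  "jacobi_mat_plus a b p = mat p p (\<lambda>(i, j).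
     if i = p - 1 \<and> j = p - 1 then b p + (a p)\<^sup>2 else jacobi_mat a b p $$ (i, j))"

definition jacobi_mat_minus :: "(nat \<Rightarrow> real) \<Rightarrow> (nat \<Rightarrow> real) \<Rightarrow> nat \<Rightarrow> real mat" where
  "jacobi_mat_minus a b p = mat p p (\<lambda>(i, j).
     if i = p - 1 \<and> j = p - 1 then b p - (a p)\<^sup>2 else jacobi_mat a b p $$ (i, j))"

(* The j-th smallest eigenvalue, j = 1, 2, ... *)
definition eigenvalue_nth :: "real mat \<Rightarrow> nat \<Rightarrow> real" where
  "eigenvalue_nth A j = sorted_list_of_set (spectrum A) ! (j - 1)"

definition alpha_plus :: "nat \<Rightarrow> (nat \<Rightarrow> real) \<Rightarrow> nat \<Rightarrow> real" where
  "alpha_plus p q j = eigenvalue_nth (jacobi_mat_plus (coeff_a q) (coeff_b q) p) j"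

definition alpha_minus :: "nat \<Rightarrow> (nat \<Rightarrow> real) \<Rightarrow> nat \<Rightarrow> real" where
  "alpha_minus p q j = eigenvalue_nth (jacobi_mat_minus (coeff_a q) (coeff_b q) p) j"

definition alpha_star :: "nat \<Rightarrow> (nat \<Rightarrow> real) \<Rightarrow> (nat \<Rightarrow> real)" where
  "alpha_star p q i =
     (if i \<in> {1..2 * p}
      then (if odd i then alpha_minus p q ((i + 1) div 2) else alpha_plus p q (i div 2))
      else 0)"

section \<open>Algorithms on real inputs\<close>

(* A branch-free finite computation on exact real numbers, using rational constants, the four field
   operations and square roots.  Division by zero and roots of negative numbers abort with None,
   so a result Some _ certifies that every operation performed was legitimate. *)
datatype real_alg =
    Input nat
  | Const rat
  | Add real_alg real_alg
  | Sub real_alg real_alg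
  | Mul real_alg real_alg
  | Div real_alg real_alg
  | Sqrt real_alg

fun run_alg :: "(nat \<Rightarrow> real) \<Rightarrow> real_alg \<Rightarrow> real option" where
  "run_alg v (Input i) = Some (v i)"
| "run_alg v (Const c) = Some (of_rat c)"
| "run_alg v (Add s t) =
     Option.bind (run_alg v s) (\<lambda>x. Option.bind (run_alg v t) (\<lambda>y. Some (x + y)))"
| "run_alg v (Sub s t) =
     Option.bind (run_alg v s) (\<lambda>x. Option.bind (run_alg v t) (\<lambda>y. Some (x - y)))"
| "run_alg v (Mul s t) =
     Option.bind (run_alg v s) (\<lambda>x. Option.bind (run_alg v t) (\<lambda>y. Some (x * y)))"
| "run_alg v (Div s t) =
     Option.bind (run_alg v s) (\<lambda>x. Option.bind (run_alg v t)
       (\<lambda>y. if y = 0 then None else Some (x / y)))"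
| "run_alg v (Sqrt s) =
     Option.bind (run_alg v s) (\<lambda>x. if x < 0 then None else Some (sqrt x))"

end

theory Submission
  imports Defs
begin

text \<open>
  Expanding determinants along the last row gives \<open>det (t - J\<^sup>\<plusminus>) = P\<^sub>p \<mp> a\<^sub>p\<^sup>2 P\<^sub>p\<^sub>-\<^sub>1\<close>, where
  \<open>P\<^sub>k\<close> is the characteristic polynomial of \<open>J\<^sub>k\<close>. The spectral data are therefore the roots of
  \<open>A \<mp> B\<close> for the pair \<open>A = P\<^sub>p\<close>, \<open>B = a\<^sub>p\<^sup>2 P\<^sub>p\<^sub>-\<^sub>1\<close>, and knowing them is the same as knowing \<open>A\<close>
  and \<open>B\<close>. The pair determines the coefficients by Euclid's algorithm: \<open>a\<^sub>p\<^sup>2\<close> is the coefficient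
  of \<open>B\<close> in degree \<open>p - 1\<close>, and dividing \<open>A\<close> by \<open>B\<close> in the three-term recurrence
  \<open>P\<^sub>p = (t - b\<^sub>p) P\<^sub>p\<^sub>-\<^sub>1 - a\<^sub>p\<^sub>-\<^sub>1\<^sup>2 P\<^sub>p\<^sub>-\<^sub>2\<close> yields \<open>b\<^sub>p\<close> and the same kind of pair one level down.
  Only field operations and one square root per \<open>a\<^sub>x\<close> occur, which is the algorithm and gives
  injectivity (\<open>run_inverse_alg\<close>).

  What has to be controlled is positivity. The invariant is that \<open>A\<close> has \<open>k\<close> simple real roots at
  which \<open>B\<close> alternates in sign (\<open>interlacing\<close>). Sign changes carry it through the recurrence in both
  directions (\<open>interlacing_up\<close>, \<open>interlacing_down\<close>), and it is equivalent to the strict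
  interlacing of the roots of \<open>A + B\<close> and \<open>A - B\<close> (\<open>interlacing_imp_interlaced\<close>,
  \<open>interlaced_imp_interlacing\<close>). Hence the spectral map is a bijection from all perturbations with
  positive \<open>a\<^sub>x\<close>, degenerate or not, onto the increasing sequences.

  Analyticity rests on one theorem (\<open>real_analytic_at_simple_root\<close>): a simple root of a polynomial
  depends analytically on a parameter if the coefficients do. It gives the eigenvalues directly.
  Division and square roots are the roots of linear and quadratic equations, so the terms of the
  algorithm are analytic too, and with them the inverse map. The theorem itself follows by
  contraction in the algebra of power series with the weighted absolute sum of coefficients
  \<open>\<Sum>\<^sub>\<nu> \<bar>c\<^sub>\<nu>\<bar> r\<^bsup>\<bar>\<nu>\<bar>\<^esup>\<close> as norm.
\<close>

(* smult is scalar multiplication of polynomials throughout, not that of modules. *)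
hide_const (open) Module.smult

section \<open>Convergent power series with a norm bound\<close>

definition polydisc :: "nat \<Rightarrow> (nat \<Rightarrow> real) \<Rightarrow> real \<Rightarrow> (nat \<Rightarrow> real) set" where
  "polydisc m x r = {y \<in> Rvec m. \<forall>i\<in>{1..m}. \<bar>y i - x i\<bar> < r}"

definition monomial :: "nat \<Rightarrow> (nat \<Rightarrow> real) \<Rightarrow> (nat \<Rightarrow> real) \<Rightarrow> (nat \<Rightarrow> nat) \<Rightarrow> real" where
  "monomial m x y \<nu> = (\<Prod>i=1..m. (y i - x i) ^ \<nu> i)"

definition mdeg :: "nat \<Rightarrow> (nat \<Rightarrow> nat) \<Rightarrow> nat" where
  "mdeg m \<nu> = (\<Sum>i=1..m. \<nu> i)"

text \<open>
  On the polydisc of radius \<open>r\<close> about \<open>x\<close>, the function is the sum of a power series of weighted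
  \<open>\<ell>\<^sup>1\<close> norm at most \<open>M\<close>. Recording a bound instead of the coefficients turns the Banach algebra
  of such series into closure rules about ordinary functions, whose ring laws are those of \<open>\<real>\<close>.
\<close>
definition analytic_bound ::
    "nat \<Rightarrow> (nat \<Rightarrow> real) \<Rightarrow> real \<Rightarrow> real \<Rightarrow> ((nat \<Rightarrow> real) \<Rightarrow> real) \<Rightarrow> bool" where
  "analytic_bound m x r M f \<longleftrightarrow>
     (\<exists>c S. ((\<lambda>\<nu>. \<bar>c \<nu>\<bar> * r ^ mdeg m \<nu>) has_sum S) (multi_indices m) \<and> S \<le> M \<and>
        (\<forall>y\<in>polydisc m x r. ((\<lambda>\<nu>. c \<nu> * monomial m x y \<nu>) has_sum f y) (multi_indices m)))"

lemma polydisc_mono: "s \<le> r \<Longrightarrow> polydisc m x s \<subseteq> polydisc m x r"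
  by (force simp: polydisc_def)

lemma abs_monomial_le:
  assumes "y \<in> polydisc m x r"
  shows "\<bar>monomial m x y \<nu>\<bar> \<le> r ^ mdeg m \<nu>"
proof -
  have "\<bar>monomial m x y \<nu>\<bar> = (\<Prod>i=1..m. \<bar>y i - x i\<bar> ^ \<nu> i)"
    by (simp add: monomial_def abs_prod power_abs)
  also have "\<dots> \<le> (\<Prod>i=1..m. r ^ \<nu> i)"
    using assms by (intro prod_mono) (fastforce simp: polydisc_def intro!: power_mono intro: less_imp_le)
  also have "\<dots> = r ^ mdeg m \<nu>"
    by (simp add: mdeg_def power_sum)
  finally show ?thesis .
qed

lemma has_sum_Sigma_of_abs:
  fixes F :: "'a \<times> 'b \<Rightarrow> real"
  assumes "\<And>x. x \<in> A \<Longrightarrow> ((\<lambda>y. \<bar>F (x, y)\<bar>) has_sum N x) (B x)" and "N summable_on A"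
    and "\<And>x. x \<in> A \<Longrightarrow> ((\<lambda>y. F (x, y)) has_sum b x) (B x)" and "(b has_sum S) A"
  shows "(F has_sum S) (Sigma A B)"
proof -
  have "(\<lambda>z. \<bar>F z\<bar>) summable_on Sigma A B"
    by (rule summable_on_SigmaI[where g = N]) (use assms in auto)
  hence "F summable_on Sigma A B"
    using summable_on_iff_abs_summable_on_real by (metis (no_types, lifting) real_norm_def summable_on_cong)
  hence F: "(F has_sum infsum F (Sigma A B)) (Sigma A B)"
    by simp
  have "(b has_sum infsum F (Sigma A B)) A"
    by (rule has_sum_SigmaD[OF F]) (use assms in auto)
  thus ?thesis
    using F assms(4) has_sum_unique by blast
qed

text \<open>
  Equal monomials in an arbitrarily indexed absolutely convergent sum can be collected; this is
  what allows products and infinite sums of power series to be written with whatever index set is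
  natural for them.
\<close>
lemma analytic_bound_collect:
  fixes d :: "'k \<Rightarrow> real" and g :: "'k \<Rightarrow> nat \<Rightarrow> nat"
  assumes r: "r > 0" and g: "\<And>k. k \<in> I \<Longrightarrow> g k \<in> multi_indices m"
    and abs: "((\<lambda>k. \<bar>d k\<bar> * r ^ mdeg m (g k)) has_sum S) I" and "S \<le> M"
    and f: "\<And>y. y \<in> polydisc m x r \<Longrightarrow> ((\<lambda>k. d k * monomial m x y (g k)) has_sum f y) I"
  shows "analytic_bound m x r M f"
proof -
  let ?MI = "multi_indices m"
  define fib where "fib \<nu> = {k \<in> I. g k = \<nu>}" for \<nu>
  define c where "c \<nu> = infsum d (fib \<nu>)" for \<nu>
  have bij: "bij_betw (\<lambda>k. (g k, k)) I (Sigma ?MI fib)"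
    by (rule bij_betwI[where g = snd]) (use g in \<open>auto simp: fib_def\<close>)
  have ab: "(\<lambda>k. \<bar>d k\<bar>) summable_on fib \<nu>" for \<nu>
  proof -
    have "(\<lambda>k. \<bar>d k\<bar> * r ^ mdeg m (g k)) summable_on fib \<nu>"
      using has_sum_imp_summable[OF abs] by (rule summable_on_subset_banach) (auto simp: fib_def)
    hence "(\<lambda>k. \<bar>d k\<bar> * r ^ mdeg m \<nu>) summable_on fib \<nu>"
      by (rule summable_on_cong[THEN iffD1, rotated]) (auto simp: fib_def)
    thus ?thesis
      using r by (subst (asm) summable_on_cmult_left') auto
  qed
  have dsum: "(d has_sum c \<nu>) (fib \<nu>)" for \<nu>
    unfolding c_def using ab[of \<nu>] abs_summable_summable[of d "fib \<nu>"] by simp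
  have eq: "((\<lambda>k. F k (g k)) has_sum T) (fib \<nu>) \<longleftrightarrow> ((\<lambda>k. F k \<nu>) has_sum T) (fib \<nu>)" for F T \<nu>
    by (rule has_sum_cong) (auto simp: fib_def)
  have abs': "((\<lambda>(\<nu>, k). \<bar>d k\<bar> * r ^ mdeg m \<nu>) has_sum S) (Sigma ?MI fib)"
    using has_sum_reindex_bij_betw[OF bij, of "\<lambda>(\<nu>, k). \<bar>d k\<bar> * r ^ mdeg m \<nu>"] abs by simp
  have A: "((\<lambda>\<nu>. infsum (\<lambda>k. \<bar>d k\<bar>) (fib \<nu>) * r ^ mdeg m \<nu>) has_sum S) ?MI"
    by (rule has_sum_SigmaD[OF abs']) (use ab in \<open>auto intro!: has_sum_cmult_left\<close>)
  have le: "\<bar>c \<nu>\<bar> \<le> infsum (\<lambda>k. \<bar>d k\<bar>) (fib \<nu>)" for \<nu>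
    unfolding c_def using norm_infsum_bound[of d "fib \<nu>"] ab by simp
  have summ: "(\<lambda>\<nu>. \<bar>c \<nu>\<bar> * r ^ mdeg m \<nu>) summable_on ?MI"
    by (rule summable_on_comparison_test[OF has_sum_imp_summable[OF A]])
       (use le r in \<open>auto intro!: mult_right_mono\<close>)
  show ?thesis
    unfolding analytic_bound_def
  proof (intro exI conjI ballI)
    show "((\<lambda>\<nu>. \<bar>c \<nu>\<bar> * r ^ mdeg m \<nu>) has_sum infsum (\<lambda>\<nu>. \<bar>c \<nu>\<bar> * r ^ mdeg m \<nu>) ?MI) ?MI"
      using summ by simp
    have "infsum (\<lambda>\<nu>. \<bar>c \<nu>\<bar> * r ^ mdeg m \<nu>) ?MI \<le> S"
      by (rule has_sum_mono[OF has_sum_infsum[OF summ] A])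
         (use le r in \<open>auto intro!: mult_right_mono\<close>)
    thus "infsum (\<lambda>\<nu>. \<bar>c \<nu>\<bar> * r ^ mdeg m \<nu>) ?MI \<le> M"
      using \<open>S \<le> M\<close> by simp
  next
    fix y assume y: "y \<in> polydisc m x r"
    have "((\<lambda>(\<nu>, k). d k * monomial m x y \<nu>) has_sum f y) (Sigma ?MI fib)"
      using has_sum_reindex_bij_betw[OF bij, of "\<lambda>(\<nu>, k). d k * monomial m x y \<nu>"] f[OF y] by simp
    thus "((\<lambda>\<nu>. c \<nu> * monomial m x y \<nu>) has_sum f y) ?MI"
      by (rule has_sum_SigmaD) (use dsum in \<open>auto intro!: has_sum_cmult_left\<close>)
  qed
qed

lemma analytic_bound_mono: "analytic_bound m x r M f \<Longrightarrow> M \<le> N \<Longrightarrow> analytic_bound m x r N f"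
  unfolding analytic_bound_def by (meson order_trans)

lemma analytic_bound_cong:
  assumes "analytic_bound m x r M f" "\<And>y. y \<in> polydisc m x r \<Longrightarrow> f y = g y"
  shows "analytic_bound m x r M g"
  using assms unfolding analytic_bound_def by metis

lemma analytic_bound_abs_le:
  assumes "analytic_bound m x r M f" "y \<in> polydisc m x r"
  shows "\<bar>f y\<bar> \<le> M"
proof -
  from assms obtain c S where c: "((\<lambda>\<nu>. \<bar>c \<nu>\<bar> * r ^ mdeg m \<nu>) has_sum S) (multi_indices m)" "S \<le> M"
    "((\<lambda>\<nu>. c \<nu> * monomial m x y \<nu>) has_sum f y) (multi_indices m)"
    unfolding analytic_bound_def by blast
  have le: "\<bar>c \<nu> * monomial m x y \<nu>\<bar> \<le> \<bar>c \<nu>\<bar> * r ^ mdeg m \<nu>" for \<nu>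
    using abs_monomial_le[OF assms(2)] by (simp add: abs_mult mult_left_mono)
  have "f y \<le> S"
    by (rule has_sum_mono[OF c(3) c(1)]) (use le abs_le_D1 in blast)
  moreover have "- f y \<le> S"
  proof (rule has_sum_mono[OF _ c(1)])
    show "((\<lambda>\<nu>. - (c \<nu> * monomial m x y \<nu>)) has_sum - f y) (multi_indices m)"
      using c(3) by (simp add: has_sum_uminus)
  qed (use le abs_le_D2 in blast)
  ultimately show ?thesis using c(2) by linarith
qed

lemma analytic_bound_nonneg:
  assumes "analytic_bound m x r M f" "r \<ge> 0"
  shows "M \<ge> 0"
proof -
  from assms obtain c S where c: "((\<lambda>\<nu>. \<bar>c \<nu>\<bar> * r ^ mdeg m \<nu>) has_sum S) (multi_indices m)" "S \<le> M"
    unfolding analytic_bound_def by blast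
  have "S \<ge> 0"
    by (rule has_sum_nonneg[OF c(1)]) (use assms(2) in auto)
  thus ?thesis using c by simp
qed

lemma analytic_bound_const:
  assumes "r > 0" shows "analytic_bound m x r \<bar>k\<bar> (\<lambda>_. k)"
  by (rule analytic_bound_collect[where I = "{()}" and g = "\<lambda>_ _. 0" and d = "\<lambda>_. k" and S = "\<bar>k\<bar>"])
     (use assms in \<open>auto simp: multi_indices_def mdeg_def monomial_def intro!: has_sum_finiteI\<close>)

lemma analytic_bound_coordinate:
  assumes "r > 0" "i \<in> {1..m}" shows "analytic_bound m x r r (\<lambda>y. y i - x i)"
proof (rule analytic_bound_collect[where I = "{()}" and g = "\<lambda>_ j. if j = i then 1 else 0" and
      d = "\<lambda>_. 1" and S = r])
  have "(\<Prod>j=1..m. (y j - x j) ^ (if j = i then 1 else 0)) = y i - x i" for y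
  proof -
    have "(\<Prod>j=1..m. (y j - x j) ^ (if j = i then 1 else 0)) = (\<Prod>j=1..m. if j = i then y j - x j else 1)"
      by (rule prod.cong) auto
    thus ?thesis using assms by simp
  qed
  thus "((\<lambda>k. 1 * monomial m x y (\<lambda>j. if j = i then 1 else 0)) has_sum y i - x i) {()}" for y
    by (auto simp: monomial_def intro!: has_sum_finiteI)
qed (use assms in \<open>auto simp: multi_indices_def mdeg_def intro!: has_sum_finiteI\<close>)

lemma analytic_bound_add:
  assumes "analytic_bound m x r M f" "analytic_bound m x r N g"
    and r: "r > 0"
  shows "analytic_bound m x r (M + N) (\<lambda>y. f y + g y)"
proof -
  let ?MI = "multi_indices m"
  from assms(1) obtain c S where c: "((\<lambda>\<nu>. \<bar>c \<nu>\<bar> * r ^ mdeg m \<nu>) has_sum S) ?MI" "S \<le> M"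
    "\<And>y. y \<in> polydisc m x r \<Longrightarrow> ((\<lambda>\<nu>. c \<nu> * monomial m x y \<nu>) has_sum f y) ?MI"
    unfolding analytic_bound_def by blast
  from assms(2) obtain d T where d: "((\<lambda>\<nu>. \<bar>d \<nu>\<bar> * r ^ mdeg m \<nu>) has_sum T) ?MI" "T \<le> N"
    "\<And>y. y \<in> polydisc m x r \<Longrightarrow> ((\<lambda>\<nu>. d \<nu> * monomial m x y \<nu>) has_sum g y) ?MI"
    unfolding analytic_bound_def by blast
  have cd: "((\<lambda>\<nu>. \<bar>c \<nu>\<bar> * r ^ mdeg m \<nu> + \<bar>d \<nu>\<bar> * r ^ mdeg m \<nu>) has_sum S + T) ?MI"
    by (rule has_sum_add[OF c(1) d(1)])
  have le: "\<bar>c \<nu> + d \<nu>\<bar> * r ^ mdeg m \<nu> \<le> \<bar>c \<nu>\<bar> * r ^ mdeg m \<nu> + \<bar>d \<nu>\<bar> * r ^ mdeg m \<nu>" for \<nu>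
    using r by (simp flip: distrib_right)
  have summ: "(\<lambda>\<nu>. \<bar>c \<nu> + d \<nu>\<bar> * r ^ mdeg m \<nu>) summable_on ?MI"
    by (rule summable_on_comparison_test[OF has_sum_imp_summable[OF cd]]) (use le r in auto)
  show ?thesis
    unfolding analytic_bound_def
  proof (intro exI conjI ballI)
    show "((\<lambda>\<nu>. \<bar>c \<nu> + d \<nu>\<bar> * r ^ mdeg m \<nu>) has_sum infsum (\<lambda>\<nu>. \<bar>c \<nu> + d \<nu>\<bar> * r ^ mdeg m \<nu>) ?MI) ?MI"
      using summ by simp
    have "infsum (\<lambda>\<nu>. \<bar>c \<nu> + d \<nu>\<bar> * r ^ mdeg m \<nu>) ?MI \<le> S + T"
      by (rule has_sum_mono[OF has_sum_infsum[OF summ] cd]) (use le in auto)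
    thus "infsum (\<lambda>\<nu>. \<bar>c \<nu> + d \<nu>\<bar> * r ^ mdeg m \<nu>) ?MI \<le> M + N"
      using c d by simp
  next
    fix y assume y: "y \<in> polydisc m x r"
    show "((\<lambda>\<nu>. (c \<nu> + d \<nu>) * monomial m x y \<nu>) has_sum f y + g y) ?MI"
      using has_sum_add[OF c(3)[OF y] d(3)[OF y]] by (simp add: distrib_right)
  qed
qed

lemma analytic_bound_mult:
  assumes "analytic_bound m x r M f" "analytic_bound m x r N g" and r: "r > 0"
  shows "analytic_bound m x r (M * N) (\<lambda>y. f y * g y)"
proof -
  let ?MI = "multi_indices m"
  from assms(1) obtain c S where c: "((\<lambda>\<nu>. \<bar>c \<nu>\<bar> * r ^ mdeg m \<nu>) has_sum S) ?MI" "S \<le> M"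
    "\<And>y. y \<in> polydisc m x r \<Longrightarrow> ((\<lambda>\<nu>. c \<nu> * monomial m x y \<nu>) has_sum f y) ?MI"
    unfolding analytic_bound_def by blast
  from assms(2) obtain d T where d: "((\<lambda>\<nu>. \<bar>d \<nu>\<bar> * r ^ mdeg m \<nu>) has_sum T) ?MI" "T \<le> N"
    "\<And>y. y \<in> polydisc m x r \<Longrightarrow> ((\<lambda>\<nu>. d \<nu> * monomial m x y \<nu>) has_sum g y) ?MI"
    unfolding analytic_bound_def by blast
  have S0: "S \<ge> 0" by (rule has_sum_nonneg[OF c(1)]) (use r in auto)
  have T0: "T \<ge> 0" by (rule has_sum_nonneg[OF d(1)]) (use r in auto)
  define h :: "(nat \<Rightarrow> nat) \<times> (nat \<Rightarrow> nat) \<Rightarrow> nat \<Rightarrow> nat" where "h = (\<lambda>(\<mu>, \<kappa>) i. \<mu> i + \<kappa> i)"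
  have deg: "mdeg m (h (\<mu>, \<kappa>)) = mdeg m \<mu> + mdeg m \<kappa>" for \<mu> \<kappa>
    by (simp add: mdeg_def h_def sum.distrib)
  have mon: "monomial m x y (h (\<mu>, \<kappa>)) = monomial m x y \<mu> * monomial m x y \<kappa>" for y \<mu> \<kappa>
    by (simp add: monomial_def h_def prod.distrib power_add)
  have prod: "((\<lambda>(\<mu>, \<kappa>). F \<mu> * G \<kappa>) has_sum P * Q) (?MI \<times> ?MI)"
    if "(F has_sum P) ?MI" "(G has_sum Q) ?MI"
      "((\<lambda>\<mu>. \<bar>F \<mu>\<bar>) has_sum P') ?MI" "((\<lambda>\<mu>. \<bar>G \<mu>\<bar>) has_sum Q') ?MI"
    for F G and P Q P' Q' :: real
  proof (rule has_sum_Sigma_of_abs[where N = "\<lambda>\<mu>. \<bar>F \<mu>\<bar> * Q'" and b = "\<lambda>\<mu>. F \<mu> * Q"])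
    show "(\<lambda>\<mu>. \<bar>F \<mu>\<bar> * Q') summable_on ?MI"
      using that by (intro summable_on_cmult_left has_sum_imp_summable)
  qed (use that in \<open>auto simp: abs_mult intro!: has_sum_cmult_left has_sum_cmult_right\<close>)
  have summable_abs: "(\<lambda>\<nu>. \<bar>e \<nu> * monomial m x y \<nu>\<bar>) summable_on ?MI"
    if "((\<lambda>\<nu>. \<bar>e \<nu>\<bar> * r ^ mdeg m \<nu>) has_sum R) ?MI" "y \<in> polydisc m x r" for e R y
    by (rule summable_on_comparison_test[OF has_sum_imp_summable[OF that(1)]])
       (use abs_monomial_le[OF that(2)] in \<open>auto simp: abs_mult mult_left_mono\<close>)
  show ?thesis
  proof (rule analytic_bound_collect[where I = "?MI \<times> ?MI" and g = h and S = "S * T"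
        and d = "\<lambda>(\<mu>, \<kappa>). c \<mu> * d \<kappa>"])
    show "((\<lambda>k. \<bar>case k of (\<mu>, \<kappa>) \<Rightarrow> c \<mu> * d \<kappa>\<bar> * r ^ mdeg m (h k)) has_sum S * T) (?MI \<times> ?MI)"
    proof (rule has_sum_cong[THEN iffD1])
      show "((\<lambda>(\<mu>, \<kappa>). (\<bar>c \<mu>\<bar> * r ^ mdeg m \<mu>) * (\<bar>d \<kappa>\<bar> * r ^ mdeg m \<kappa>)) has_sum S * T) (?MI \<times> ?MI)"
        by (rule prod[OF c(1) d(1)]) (use c(1) d(1) r in \<open>auto simp: abs_mult\<close>)
    qed (auto simp: deg power_add abs_mult)
    show "S * T \<le> M * N"
      using c(2) d(2) S0 T0 by (intro mult_mono) auto
    fix y assume y: "y \<in> polydisc m x r"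
    show "((\<lambda>k. (case k of (\<mu>, \<kappa>) \<Rightarrow> c \<mu> * d \<kappa>) * monomial m x y (h k)) has_sum f y * g y) (?MI \<times> ?MI)"
    proof (rule has_sum_cong[THEN iffD1])
      show "((\<lambda>(\<mu>, \<kappa>). (c \<mu> * monomial m x y \<mu>) * (d \<kappa> * monomial m x y \<kappa>)) has_sum f y * g y) (?MI \<times> ?MI)"
        by (rule prod[OF c(3)[OF y] d(3)[OF y] has_sum_infsum has_sum_infsum])
           (use summable_abs[OF c(1) y] summable_abs[OF d(1) y] in auto)
    qed (auto simp: mon)
  qed (use r in \<open>auto simp: h_def multi_indices_def\<close>)
qed

text \<open>
  This is the completeness of the algebra: norm-convergent series have a limit in it.
\<close>
lemma analytic_bound_suminf:
  fixes f :: "nat \<Rightarrow> (nat \<Rightarrow> real) \<Rightarrow> real"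
  assumes f: "\<And>n. analytic_bound m x r (M n) (f n)" and M: "M sums T" and r: "r > 0"
  shows "analytic_bound m x r T (\<lambda>y. \<Sum>n. f n y)"
proof -
  let ?MI = "multi_indices m"
  from f have "\<forall>n. \<exists>c S. ((\<lambda>\<nu>. \<bar>c \<nu>\<bar> * r ^ mdeg m \<nu>) has_sum S) ?MI \<and> S \<le> M n \<and>
    (\<forall>y. y \<in> polydisc m x r \<longrightarrow> ((\<lambda>\<nu>. c \<nu> * monomial m x y \<nu>) has_sum f n y) ?MI)"
    unfolding analytic_bound_def by blast
  then obtain c S where c: "\<And>n. ((\<lambda>\<nu>. \<bar>c n \<nu>\<bar> * r ^ mdeg m \<nu>) has_sum S n) ?MI" "\<And>n. S n \<le> M n"
    "\<And>n y. y \<in> polydisc m x r \<Longrightarrow> ((\<lambda>\<nu>. c n \<nu> * monomial m x y \<nu>) has_sum f n y) ?MI"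
    by metis
  have S0: "S n \<ge> 0" for n by (rule has_sum_nonneg[OF c(1)]) (use r in auto)
  have M0: "M n \<ge> 0" for n using c(2)[of n] S0[of n] by simp
  have sM: "summable M" using M by (rule sums_summable)
  have sS: "summable S"
    by (rule summable_comparison_test'[OF sM, of 0]) (use S0 c in auto)
  have S: "(S has_sum suminf S) UNIV"
    by (rule norm_summable_imp_has_sum) (use sS S0 in auto)
  have summable_abs: "(\<lambda>\<nu>. \<bar>c n \<nu> * monomial m x y \<nu>\<bar>) summable_on ?MI"
    and abs_le: "infsum (\<lambda>\<nu>. \<bar>c n \<nu> * monomial m x y \<nu>\<bar>) ?MI \<le> S n"
    if "y \<in> polydisc m x r" for n y
  proof -
    have le: "\<bar>c n \<nu> * monomial m x y \<nu>\<bar> \<le> \<bar>c n \<nu>\<bar> * r ^ mdeg m \<nu>" for \<nu>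
      using abs_monomial_le[OF that] by (auto simp: abs_mult mult_left_mono)
    show *: "(\<lambda>\<nu>. \<bar>c n \<nu> * monomial m x y \<nu>\<bar>) summable_on ?MI"
      by (rule summable_on_comparison_test[OF has_sum_imp_summable[OF c(1)[of n]]]) (use le in auto)
    show "infsum (\<lambda>\<nu>. \<bar>c n \<nu> * monomial m x y \<nu>\<bar>) ?MI \<le> S n"
      by (rule has_sum_mono[OF has_sum_infsum[OF *] c(1)]) (use le in auto)
  qed
  show ?thesis
  proof (rule analytic_bound_collect[where I = "UNIV \<times> ?MI" and g = snd and S = "suminf S"
        and d = "\<lambda>(n, \<nu>). c n \<nu>"])
    show "((\<lambda>k. \<bar>case k of (n, \<nu>) \<Rightarrow> c n \<nu>\<bar> * r ^ mdeg m (snd k)) has_sum suminf S) (UNIV \<times> ?MI)"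
      by (rule has_sum_Sigma_of_abs[where N = S and b = S])
         (use c(1) S r in \<open>auto simp: abs_mult intro: has_sum_imp_summable\<close>)
    have "suminf S \<le> suminf M" by (rule suminf_le[OF _ sS sM]) (rule c(2))
    thus "suminf S \<le> T" using M by (simp add: sums_iff)
    fix y assume y: "y \<in> polydisc m x r"
    have fS: "\<bar>f n y\<bar> \<le> S n" for n
      using norm_has_sum_bound[OF _ c(3)[OF y, of n]] has_sum_infsum[OF summable_abs[OF y, of n]]
        abs_le[OF y, of n] by fastforce
    have "((\<lambda>n. f n y) has_sum (\<Sum>n. f n y)) UNIV"
      by (rule norm_summable_imp_has_sum)
         (use fS sS in \<open>auto intro!: summable_sums summable_comparison_test'[OF sS, of 0]\<close>)
    thus "((\<lambda>k. (case k of (n, \<nu>) \<Rightarrow> c n \<nu>) * monomial m x y (snd k)) has_sum (\<Sum>n. f n y)) (UNIV \<times> ?MI)"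
    proof (intro has_sum_Sigma_of_abs[where N = "\<lambda>n. infsum (\<lambda>\<nu>. \<bar>c n \<nu> * monomial m x y \<nu>\<bar>) ?MI"
          and b = "\<lambda>n. f n y"])
      show "(\<lambda>n. infsum (\<lambda>\<nu>. \<bar>c n \<nu> * monomial m x y \<nu>\<bar>) ?MI) summable_on UNIV"
        by (rule summable_on_comparison_test[OF has_sum_imp_summable[OF S]])
           (use abs_le[OF y] in \<open>auto intro!: infsum_nonneg\<close>)
    qed (use c(3)[OF y] has_sum_infsum[OF summable_abs[OF y]] in auto)
  qed (use r in auto)
qed

lemma analytic_bound_shrink:
  assumes "analytic_bound m x r M f" "0 < s" "s \<le> r"
  shows "analytic_bound m x s M f"
proof -
  from assms(1) obtain c S where c: "((\<lambda>\<nu>. \<bar>c \<nu>\<bar> * r ^ mdeg m \<nu>) has_sum S) (multi_indices m)" "S \<le> M"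
    "\<And>y. y \<in> polydisc m x r \<Longrightarrow> ((\<lambda>\<nu>. c \<nu> * monomial m x y \<nu>) has_sum f y) (multi_indices m)"
    unfolding analytic_bound_def by blast
  have le: "\<bar>c \<nu>\<bar> * s ^ mdeg m \<nu> \<le> \<bar>c \<nu>\<bar> * r ^ mdeg m \<nu>" for \<nu>
    using assms by (intro mult_left_mono power_mono) auto
  have summ: "(\<lambda>\<nu>. \<bar>c \<nu>\<bar> * s ^ mdeg m \<nu>) summable_on multi_indices m"
    by (rule summable_on_comparison_test[OF has_sum_imp_summable[OF c(1)]]) (use le assms in auto)
  have "infsum (\<lambda>\<nu>. \<bar>c \<nu>\<bar> * s ^ mdeg m \<nu>) (multi_indices m) \<le> S"
    by (rule has_sum_mono[OF has_sum_infsum[OF summ] c(1)]) (use le in auto)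
  thus ?thesis
    unfolding analytic_bound_def using has_sum_infsum[OF summ] c polydisc_mono[OF assms(3)]
    by (meson order_trans subsetD)
qed

text \<open>
  A power series without constant term carries a factor \<open>s / r\<close> on the smaller polydisc of radius
  \<open>s\<close>, since each of its monomials has degree at least one.  This makes small norms available.
\<close>
lemma analytic_bound_shrink_diff:
  assumes "analytic_bound m x r M f" "0 < s" "s \<le> r" "x \<in> Rvec m"
  shows "analytic_bound m x s (s / r * M) (\<lambda>y. f y - f x)"
proof -
  let ?MI = "multi_indices m"
  have r: "r > 0" using assms by simp
  from assms(1) obtain c S where c: "((\<lambda>\<nu>. \<bar>c \<nu>\<bar> * r ^ mdeg m \<nu>) has_sum S) ?MI" "S \<le> M"
    "\<And>y. y \<in> polydisc m x r \<Longrightarrow> ((\<lambda>\<nu>. c \<nu> * monomial m x y \<nu>) has_sum f y) ?MI"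
    unfolding analytic_bound_def by blast
  define z where "z = (\<lambda>_::nat. 0::nat)"
  have z: "z \<in> ?MI" by (simp add: z_def multi_indices_def)
  have deg0: "mdeg m \<nu> \<ge> 1" if "\<nu> \<in> ?MI" "\<nu> \<noteq> z" for \<nu>
  proof (rule ccontr)
    assume "\<not> mdeg m \<nu> \<ge> 1"
    hence "mdeg m \<nu> = 0" by simp
    hence "\<forall>i\<in>{1..m}. \<nu> i = 0" by (simp add: mdeg_def)
    hence "\<nu> i = 0" for i using that(1) by (cases "i \<in> {1..m}") (auto simp: multi_indices_def)
    hence "\<nu> = z" by (auto simp: z_def)
    thus False using that by simp
  qed
  have monz: "monomial m x y z = 1" for y by (simp add: monomial_def z_def)
  have monx: "monomial m x x \<nu> = 0" if "\<nu> \<in> ?MI" "\<nu> \<noteq> z" for \<nu>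
  proof -
    from that obtain i where "\<nu> i \<noteq> 0" unfolding z_def by auto
    moreover from this have "i \<in> {1..m}" using that(1) by (auto simp: multi_indices_def)
    ultimately show ?thesis unfolding monomial_def by (intro prod_zero) auto
  qed
  have "x \<in> polydisc m x r" using assms r by (simp add: polydisc_def)
  from c(3)[OF this] have "((\<lambda>\<nu>. c \<nu> * monomial m x x \<nu>) has_sum f x) ?MI" .
  moreover have "((\<lambda>\<nu>. c \<nu> * monomial m x x \<nu>) has_sum c z) ?MI \<longleftrightarrow>
      ((\<lambda>\<nu>. c \<nu> * monomial m x x \<nu>) has_sum c z) {z}"
    by (rule has_sum_cong_neutral) (use monx z in auto)
  hence "((\<lambda>\<nu>. c \<nu> * monomial m x x \<nu>) has_sum c z) ?MI"
    by (simp add: has_sum_finiteI monz)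
  ultimately have fx: "f x = c z" using has_sum_unique by blast
  have sub: "\<nu> \<in> ?MI - {z} \<Longrightarrow> \<nu> \<in> ?MI \<and> \<nu> \<noteq> z" for \<nu> by auto
  have le: "\<bar>c \<nu>\<bar> * s ^ mdeg m \<nu> \<le> s / r * (\<bar>c \<nu>\<bar> * r ^ mdeg m \<nu>)" if "\<nu> \<in> ?MI - {z}" for \<nu>
  proof -
    from deg0[of \<nu>] that obtain k where k: "mdeg m \<nu> = Suc k"
      by (metis sub Suc_le_D One_nat_def)
    have "s ^ k \<le> r ^ k" using assms by (intro power_mono) auto
    hence "\<bar>c \<nu>\<bar> * s * s ^ k \<le> \<bar>c \<nu>\<bar> * s * r ^ k"
      using assms(2) by (intro mult_left_mono) auto
    thus ?thesis using r unfolding k by (simp add: mult_ac)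
  qed
  have cr: "(\<lambda>\<nu>. s / r * (\<bar>c \<nu>\<bar> * r ^ mdeg m \<nu>)) summable_on ?MI"
    using c(1) by (intro summable_on_cmult_right has_sum_imp_summable)
  hence cr': "(\<lambda>\<nu>. s / r * (\<bar>c \<nu>\<bar> * r ^ mdeg m \<nu>)) summable_on (?MI - {z})"
    by (rule summable_on_subset_banach) auto
  have summ: "(\<lambda>\<nu>. \<bar>c \<nu>\<bar> * s ^ mdeg m \<nu>) summable_on (?MI - {z})"
    by (rule summable_on_comparison_test[OF cr']) (use le assms in auto)
  show ?thesis
  proof (rule analytic_bound_collect[where I = "?MI - {z}" and g = "\<lambda>\<nu>. \<nu>" and d = c])
    show "((\<lambda>k. \<bar>c k\<bar> * s ^ mdeg m k) has_sum (\<Sum>\<^sub>\<infinity>\<nu>\<in>?MI - {z}. \<bar>c \<nu>\<bar> * s ^ mdeg m \<nu>)) (?MI - {z})"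
      using summ by simp
    have "(\<Sum>\<^sub>\<infinity>\<nu>\<in>?MI - {z}. \<bar>c \<nu>\<bar> * s ^ mdeg m \<nu>) \<le> (\<Sum>\<^sub>\<infinity>\<nu>\<in>?MI. s / r * (\<bar>c \<nu>\<bar> * r ^ mdeg m \<nu>))"
      by (rule infsum_mono_neutral[OF summ cr]) (use le r assms in auto)
    also have "\<dots> = s / r * S"
      by (intro infsumI has_sum_cmult_right c(1))
    also have "\<dots> \<le> s / r * M"
      using c(2) assms r by (intro mult_left_mono) auto
    finally show "(\<Sum>\<^sub>\<infinity>\<nu>\<in>?MI - {z}. \<bar>c \<nu>\<bar> * s ^ mdeg m \<nu>) \<le> s / r * M" .
    fix y assume "y \<in> polydisc m x s"
    hence "y \<in> polydisc m x r" using polydisc_mono[OF assms(3)] by blast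
    from c(3)[OF this] show "((\<lambda>k. c k * monomial m x y k) has_sum f y - f x) (?MI - {z})"
      using has_sum_Diff[of "\<lambda>k. c k * monomial m x y k" ?MI "f y" "{z}" "f x"] z
      by (simp add: has_sum_finiteI monz fx)
  qed (use assms in auto)
qed

section \<open>Analytic functions and simple roots\<close>

text \<open>
  The neighbourhood filter of \<open>x\<close> inside \<open>Rvec m\<close>, where the ambient function space has
  further coordinates that must stay \<open>0\<close>.
\<close>
definition near :: "nat \<Rightarrow> (nat \<Rightarrow> real) \<Rightarrow> (nat \<Rightarrow> real) filter" where
  "near m x = (INF s\<in>{0<..}. principal (polydisc m x s))"

lemma eventually_near:
  "eventually P (near m x) \<longleftrightarrow> (\<exists>s>0. \<forall>y\<in>polydisc m x s. P y)"
  unfolding near_def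
proof (subst eventually_INF_base)
  fix a b :: real assume "a \<in> {0<..}" "b \<in> {0<..}"
  thus "\<exists>s\<in>{0<..}. principal (polydisc m x s) \<le> inf (principal (polydisc m x a)) (principal (polydisc m x b))"
    by (intro bexI[of _ "min a b"]) (simp_all add: polydisc_mono)
qed (auto simp: eventually_principal)

lemma eventually_near_Rvec: "eventually (\<lambda>y. y \<in> Rvec m) (near m x)"
  unfolding eventually_near by (intro exI[of _ 1]) (auto simp: polydisc_def)

definition real_analytic_at :: "nat \<Rightarrow> (nat \<Rightarrow> real) \<Rightarrow> ((nat \<Rightarrow> real) \<Rightarrow> real) \<Rightarrow> bool" where
  "real_analytic_at m x f \<longleftrightarrow> (\<exists>r>0. \<exists>M. analytic_bound m x r M f)"

lemma real_analytic_at_cong: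
  assumes "real_analytic_at m x f" "eventually (\<lambda>y. f y = g y) (near m x)"
  shows "real_analytic_at m x g"
proof -
  from assms(1) obtain r M where r: "r > 0" "analytic_bound m x r M f"
    unfolding real_analytic_at_def by blast
  from assms(2) obtain s where s: "s > 0" "\<forall>y\<in>polydisc m x s. f y = g y"
    unfolding eventually_near by blast
  have "analytic_bound m x (min r s) M f"
    by (rule analytic_bound_shrink[OF r(2)]) (use r s in auto)
  hence "analytic_bound m x (min r s) M g"
    by (rule analytic_bound_cong) (use s polydisc_mono[of "min r s" s m x] in auto)
  thus ?thesis
    unfolding real_analytic_at_def using r s by (intro exI[of _ "min r s"]) auto
qed

text \<open>
  Two expansions have different radii; both are valid on the smaller polydisc with the same bounds.
\<close>
lemma real_analytic_at_binary:
  assumes "real_analytic_at m x f" "real_analytic_at m x g"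
    and "\<And>r M N. r > 0 \<Longrightarrow> analytic_bound m x r M f \<Longrightarrow> analytic_bound m x r N g \<Longrightarrow>
      analytic_bound m x r (K M N) h"
  shows "real_analytic_at m x h"
proof -
  from assms(1,2) obtain r M s N where rs: "r > 0" "analytic_bound m x r M f"
    "s > 0" "analytic_bound m x s N g"
    unfolding real_analytic_at_def by blast
  have "analytic_bound m x (min r s) (K M N) h"
    by (rule assms(3)) (use rs in \<open>auto intro: analytic_bound_shrink\<close>)
  thus ?thesis
    unfolding real_analytic_at_def using rs by (intro exI[of _ "min r s"]) auto
qed

lemma real_analytic_at_add:
  "real_analytic_at m x f \<Longrightarrow> real_analytic_at m x g \<Longrightarrow> real_analytic_at m x (\<lambda>y. f y + g y)"
  by (rule real_analytic_at_binary[where f = f and g = g and K = "(+)"]) (simp_all add: analytic_bound_add)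

lemma real_analytic_at_mult:
  "real_analytic_at m x f \<Longrightarrow> real_analytic_at m x g \<Longrightarrow> real_analytic_at m x (\<lambda>y. f y * g y)"
  by (rule real_analytic_at_binary[where f = f and g = g and K = "(*)"]) (simp_all add: analytic_bound_mult)

lemma real_analytic_at_const: "real_analytic_at m x (\<lambda>_. k)"
  unfolding real_analytic_at_def
  by (intro exI[of _ 1] conjI exI[of _ "\<bar>k\<bar>"] analytic_bound_const) simp_all

lemma real_analytic_at_uminus:
  "real_analytic_at m x f \<Longrightarrow> real_analytic_at m x (\<lambda>y. - f y)"
  using real_analytic_at_mult[OF real_analytic_at_const[of m x "-1"]] by simp

lemma real_analytic_at_diff:
  "real_analytic_at m x f \<Longrightarrow> real_analytic_at m x g \<Longrightarrow> real_analytic_at m x (\<lambda>y. f y - g y)"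
  using real_analytic_at_add[OF _ real_analytic_at_uminus, of m x f g] by simp

lemma real_analytic_at_power:
  "real_analytic_at m x f \<Longrightarrow> real_analytic_at m x (\<lambda>y. f y ^ k)"
  by (induction k) (auto intro: real_analytic_at_mult real_analytic_at_const)

lemma real_analytic_at_sum:
  "(\<And>k. k \<in> A \<Longrightarrow> real_analytic_at m x (f k)) \<Longrightarrow> real_analytic_at m x (\<lambda>y. \<Sum>k\<in>A. f k y)"
  by (induction A rule: infinite_finite_induct) (auto intro: real_analytic_at_add real_analytic_at_const)

lemma real_analytic_at_coeff_pCons:
  "real_analytic_at m x f \<Longrightarrow> (\<And>k. real_analytic_at m x (\<lambda>y. coeff (P y) k)) \<Longrightarrow>
    real_analytic_at m x (\<lambda>y. coeff (pCons (f y) (P y)) k)"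
  by (cases k) simp_all

lemma real_analytic_at_coordinate: "real_analytic_at m x (\<lambda>y. y i)"
proof (cases "i \<in> {1..m}")
  case True
  have "real_analytic_at m x (\<lambda>y. y i - x i)"
    unfolding real_analytic_at_def
    by (intro exI[of _ 1] conjI analytic_bound_coordinate True) simp_all
  from real_analytic_at_add[OF this real_analytic_at_const[of m x "x i"]] show ?thesis by simp
next
  case False
  show ?thesis
    by (rule real_analytic_at_cong[OF real_analytic_at_const[of m x 0]],
        rule eventually_mono[OF eventually_near_Rvec]) (use False in \<open>auto simp: Rvec_def\<close>)
qed

lemma real_analytic_at_near:
  assumes "real_analytic_at m x f" "x \<in> Rvec m" "e > 0"
  shows "eventually (\<lambda>y. \<bar>f y - f x\<bar> < e) (near m x)"
proof -
  from assms(1) obtain r M where r: "r > 0" "analytic_bound m x r M f"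
    unfolding real_analytic_at_def by blast
  have M: "M \<ge> 0" using analytic_bound_nonneg[OF r(2)] r(1) by simp
  define s where "s = min r (r * e / (2 * (1 + M)))"
  have s: "s > 0" "s \<le> r" using r M assms by (auto simp: s_def)
  have "s / r * M \<le> e / (2 * (1 + M)) * M"
  proof (intro mult_right_mono M)
    have "s \<le> e / (2 * (1 + M)) * r" by (simp add: s_def mult_ac)
    thus "s / r \<le> e / (2 * (1 + M))" using pos_divide_le_eq[OF r(1)] by blast
  qed
  also have "\<dots> < e"
    using M assms(3) by (simp add: field_simps add_nonneg_pos)
  finally have "s / r * M < e" .
  moreover have "\<bar>f y - f x\<bar> \<le> s / r * M" if "y \<in> polydisc m x s" for y
    by (rule analytic_bound_abs_le[OF analytic_bound_shrink_diff[OF r(2) s assms(2)] that])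
  ultimately show ?thesis
    unfolding eventually_near using s by (intro exI[of _ s]) fastforce
qed

lemma real_analytic_at_near_pos:
  assumes "real_analytic_at m x f" "x \<in> Rvec m" "f x > 0"
  shows "eventually (\<lambda>y. f y > 0) (near m x)"
  by (rule eventually_mono[OF real_analytic_at_near[OF assms]]) auto

lemma real_analytic_at_near_neq:
  assumes "real_analytic_at m x f" "x \<in> Rvec m" "f x \<noteq> 0"
  shows "eventually (\<lambda>y. f y \<noteq> 0) (near m x)"
  by (rule eventually_mono[OF real_analytic_at_near[OF assms(1,2), of "\<bar>f x\<bar>"]]) (use assms in auto)


lemma real_analytic_mapI:
  assumes "U \<subseteq> Rvec m" "f ` U \<subseteq> Rvec k"
    and "\<And>x. x \<in> U \<Longrightarrow> eventually (\<lambda>y. y \<in> U) (near m x)"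
    and "\<And>x j. x \<in> U \<Longrightarrow> j \<in> {1..k} \<Longrightarrow> real_analytic_at m x (\<lambda>y. f y j)"
  shows "real_analytic_map m k f U"
  unfolding real_analytic_map_def
proof (intro conjI ballI)
  fix x j assume xj: "x \<in> U" "j \<in> {1..k}"
  from assms(4)[OF xj] obtain r M where r: "r > 0" "analytic_bound m x r M (\<lambda>y. f y j)"
    unfolding real_analytic_at_def by blast
  from assms(3)[OF xj(1)] obtain s where s: "s > 0" "\<forall>y\<in>polydisc m x s. y \<in> U"
    unfolding eventually_near by blast
  have "analytic_bound m x (min r s) M (\<lambda>y. f y j)"
    by (rule analytic_bound_shrink[OF r(2)]) (use r s in auto)
  then obtain c where
    c: "\<forall>y\<in>polydisc m x (min r s). ((\<lambda>\<nu>. c \<nu> * monomial m x y \<nu>) has_sum f y j) (multi_indices m)"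
    unfolding analytic_bound_def by blast
  show "\<exists>r>0. \<exists>c. \<forall>y\<in>Rvec m. (\<forall>i\<in>{1..m}. \<bar>y i - x i\<bar> < r) \<longrightarrow> y \<in> U \<and>
     ((\<lambda>\<nu>. c \<nu> * (\<Prod>i = 1..m. (y i - x i) ^ \<nu> i)) has_sum f y j) (multi_indices m)"
    using c s r by (intro exI[of _ "min r s"] exI[of _ c]) (auto simp: polydisc_def monomial_def)
qed (use assms in auto)

lemma analytic_bound_power:
  assumes "analytic_bound m x r M f" "r > 0"
  shows "analytic_bound m x r (M ^ k) (\<lambda>y. f y ^ k)"
proof (induction k)
  case 0
  show ?case using analytic_bound_const[OF assms(2), of m x 1] by simp
next
  case (Suc k)
  show ?case using analytic_bound_mult[OF assms(1) Suc assms(2)] by simp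
qed

lemma analytic_bound_sum:
  assumes "\<And>k. k \<in> A \<Longrightarrow> analytic_bound m x r (M k) (f k)" "finite A" "r > 0"
  shows "analytic_bound m x r (\<Sum>k\<in>A. M k) (\<lambda>y. \<Sum>k\<in>A. f k y)"
  using assms(2,1)
proof (induction A rule: finite_induct)
  case empty
  show ?case using analytic_bound_const[OF assms(3), of m x 0] by simp
next
  case (insert a A)
  thus ?case using analytic_bound_add[of m x r "M a" "f a"] assms(3) by simp
qed

text \<open>
  The telescoping \<open>a\<^sup>k\<^sup>+\<^sup>1 - b\<^sup>k\<^sup>+\<^sup>1 = a (a\<^sup>k - b\<^sup>k) + (a - b) b\<^sup>k\<close> gives the derivative bound
  \<open>k \<delta>\<^sup>k\<^sup>-\<^sup>1\<close> as Lipschitz constant of the power on the ball of radius \<open>\<delta>\<close>.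
\<close>
lemma analytic_bound_power_diff:
  assumes a: "analytic_bound m x r \<delta> a" and b: "analytic_bound m x r \<delta> b"
    and ab: "analytic_bound m x r \<eta> (\<lambda>y. a y - b y)" and r: "r > 0"
  shows "analytic_bound m x r (of_nat k * \<delta> ^ (k - 1) * \<eta>) (\<lambda>y. a y ^ k - b y ^ k)"
proof (induction k)
  case 0
  show ?case using analytic_bound_const[OF r, of m x 0] by simp
next
  case (Suc k)
  have "analytic_bound m x r (\<delta> * (of_nat k * \<delta> ^ (k - 1) * \<eta>) + \<eta> * \<delta> ^ k)
      (\<lambda>y. a y * (a y ^ k - b y ^ k) + (a y - b y) * b y ^ k)"
    by (intro analytic_bound_add analytic_bound_mult[OF a] analytic_bound_mult[OF ab]
        analytic_bound_power[OF b] Suc r)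
  moreover have "\<delta> * (of_nat k * \<delta> ^ (k - 1) * \<eta>) + \<eta> * \<delta> ^ k = of_nat (Suc k) * \<delta> ^ (Suc k - 1) * \<eta>"
    by (cases k) (auto simp: algebra_simps)
  moreover have "(\<lambda>y. a y * (a y ^ k - b y ^ k) + (a y - b y) * b y ^ k) = (\<lambda>y. a y ^ Suc k - b y ^ Suc k)"
    by (simp add: algebra_simps)
  ultimately show ?case by metis
qed

text \<open>
  The hypotheses say that \<open>v \<mapsto> \<Sum>\<^sub>k g\<^sub>k v\<^sup>k\<close> maps the ball of radius \<open>\<delta>\<close> into itself and halves
  distances there. The iterates from \<open>0\<close> therefore differ by at most \<open>\<delta> / 2\<^sup>j\<^sup>+\<^sup>1\<close>, and their limit,
  a norm-convergent series of differences, is analytic on the same polydisc. Where \<open>g\<^sub>0\<close> vanishes,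
  all iterates and hence the limit vanish.
\<close>
lemma analytic_fixed_point:
  fixes g :: "nat \<Rightarrow> (nat \<Rightarrow> real) \<Rightarrow> real"
  assumes r: "r > 0" and g: "\<And>k. k \<le> n \<Longrightarrow> analytic_bound m x r (N k) (g k)"
    and N0: "N 0 \<le> \<delta> / 2" and N: "(\<Sum>k\<le>n. N k * (of_nat k * \<delta> ^ (k - 1))) \<le> 1 / 2"
  obtains v where "analytic_bound m x r \<delta> v"
    "\<And>y. y \<in> polydisc m x r \<Longrightarrow> v y = (\<Sum>k\<le>n. g k y * v y ^ k)"
    "\<And>y. g 0 y = 0 \<Longrightarrow> v y = 0"
proof -
  have Npos: "N k \<ge> 0" if "k \<le> n" for k
    using analytic_bound_nonneg[OF g[OF that]] r by simp
  have \<delta>: "\<delta> \<ge> 0" using Npos[of 0] N0 by simp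
  define \<Phi> where "\<Phi> a = (\<lambda>y. \<Sum>k\<le>n. g k y * a y ^ k)" for a :: "(nat \<Rightarrow> real) \<Rightarrow> real"
  have ball: "analytic_bound m x r \<delta> (\<Phi> a)" if "analytic_bound m x r \<delta> a" for a
  proof -
    have "analytic_bound m x r (\<Sum>k\<le>n. N k * \<delta> ^ k) (\<Phi> a)"
      unfolding \<Phi>_def
      by (intro analytic_bound_sum analytic_bound_mult analytic_bound_power that g r) auto
    moreover have "(\<Sum>k\<le>n. N k * \<delta> ^ k) \<le> \<delta>"
    proof -
      have "(\<Sum>k\<le>n. N k * \<delta> ^ k) \<le> (\<Sum>k\<le>n. (if k = 0 then N 0 else 0) + N k * (of_nat k * \<delta> ^ (k - 1)) * \<delta>)"
      proof (rule sum_mono)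
        fix k assume k: "k \<in> {..n}"
        show "N k * \<delta> ^ k \<le> (if k = 0 then N 0 else 0) + N k * (of_nat k * \<delta> ^ (k - 1)) * \<delta>"
        proof (cases k)
          case (Suc j)
          have "N k * \<delta> ^ k * 1 \<le> N k * \<delta> ^ k * of_nat k"
            using Npos[of k] k \<delta> Suc by (intro mult_left_mono) auto
          thus ?thesis using Suc by (simp add: mult_ac)
        qed auto
      qed
      also have "\<dots> = N 0 + (\<Sum>k\<le>n. N k * (of_nat k * \<delta> ^ (k - 1))) * \<delta>"
        by (simp add: sum.distrib sum_distrib_right)
      also have "\<dots> \<le> \<delta> / 2 + 1 / 2 * \<delta>"
        by (intro add_mono N0 mult_right_mono N \<delta>)
      finally show ?thesis by simp
    qed
    ultimately show ?thesis by (rule analytic_bound_mono)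
  qed
  have contr: "analytic_bound m x r (\<eta> / 2) (\<lambda>y. \<Phi> a y - \<Phi> b y)"
    if ab: "analytic_bound m x r \<delta> a" "analytic_bound m x r \<delta> b"
      "analytic_bound m x r \<eta> (\<lambda>y. a y - b y)" for a b \<eta>
  proof -
    have \<eta>: "\<eta> \<ge> 0" using analytic_bound_nonneg[OF ab(3)] r by simp
    have "analytic_bound m x r (\<Sum>k\<le>n. N k * (of_nat k * \<delta> ^ (k - 1) * \<eta>))
        (\<lambda>y. \<Phi> a y - \<Phi> b y)"
      unfolding \<Phi>_def sum_subtractf[symmetric] right_diff_distrib[symmetric]
      by (intro analytic_bound_sum analytic_bound_mult analytic_bound_power_diff ab g r) auto
    moreover have "(\<Sum>k\<le>n. N k * (of_nat k * \<delta> ^ (k - 1) * \<eta>)) =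
        (\<Sum>k\<le>n. N k * (of_nat k * \<delta> ^ (k - 1))) * \<eta>"
      by (simp only: sum_distrib_right mult.assoc)
    moreover have "(\<Sum>k\<le>n. N k * (of_nat k * \<delta> ^ (k - 1))) * \<eta> \<le> \<eta> / 2"
      using mult_right_mono[OF N \<eta>] by simp
    ultimately show ?thesis by (simp only: analytic_bound_mono)
  qed
  define V where "V j = (\<Phi> ^^ j) (\<lambda>_. 0)" for j
  have VS: "V (Suc j) = \<Phi> (V j)" for j by (simp add: V_def)
  have V0: "V 0 = (\<lambda>_. 0)" by (simp add: V_def)
  have \<Phi>0: "\<Phi> a y = g 0 y" if "a y = 0" for a y
    by (simp add: \<Phi>_def that power_0_left sum.delta if_distrib cong: if_cong)
  have Vball: "analytic_bound m x r \<delta> (V j)" for j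
  proof (induction j)
    case 0
    show ?case unfolding V0
      by (rule analytic_bound_mono[OF analytic_bound_const[OF r]]) (use \<delta> in auto)
  qed (auto simp: VS intro: ball)
  have Vdiff: "analytic_bound m x r (\<delta> * (1 / 2) ^ Suc j) (\<lambda>y. V (Suc j) y - V j y)" for j
  proof (induction j)
    case 0
    have "analytic_bound m x r (\<delta> / 2) (g 0)"
      using g[of 0] N0 by (auto intro: analytic_bound_mono)
    thus ?case by (simp add: VS V0 \<Phi>0)
  next
    case (Suc j)
    show ?case
      unfolding VS[of "Suc j"] VS[of j] using contr[OF Vball Vball Suc] by (simp add: VS)
  qed
  define v where "v = (\<lambda>y. \<Sum>j. V (Suc j) y - V j y)"
  have sums: "(\<lambda>j. \<delta> * (1 / 2) ^ Suc j) sums \<delta>"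
    using sums_mult[OF power_half_series, of \<delta>] by simp
  show ?thesis
  proof
    show "analytic_bound m x r \<delta> v"
      unfolding v_def by (rule analytic_bound_suminf[OF Vdiff sums r])
  next
    fix y assume y: "y \<in> polydisc m x r"
    have "summable (\<lambda>j. V (Suc j) y - V j y)"
      by (rule summable_comparison_test'[OF sums_summable[OF sums], of 0])
         (use analytic_bound_abs_le[OF Vdiff y] in simp)
    from summable_LIMSEQ[OF this] have lim: "(\<lambda>n. V n y) \<longlonglongrightarrow> v y"
      by (simp add: v_def sum_lessThan_telescope[of "\<lambda>j. V j y"] V0)
    have "(\<lambda>j. V (Suc j) y) \<longlonglongrightarrow> (\<Sum>k\<le>n. g k y * v y ^ k)"
      unfolding VS \<Phi>_def by (intro tendsto_intros lim)
    with LIMSEQ_Suc[OF lim] show "v y = (\<Sum>k\<le>n. g k y * v y ^ k)"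
      using LIMSEQ_unique by blast
  next
    fix y assume "g 0 y = 0"
    hence "V j y = 0" for j by (induction j) (simp_all add: V0 VS \<Phi>0)
    thus "v y = 0" by (simp add: v_def)
  qed
qed

lemma real_analytic_at_uniform:
  assumes "\<And>k. k \<in> A \<Longrightarrow> real_analytic_at m x (g k)" "finite A"
  obtains r M where "r > 0" "\<And>k. k \<in> A \<Longrightarrow> analytic_bound m x r (M k) (g k)"
proof -
  have "\<exists>r>0. \<forall>k\<in>A. \<exists>M. analytic_bound m x r M (g k)"
    using assms(2,1)
  proof (induction A rule: finite_induct)
    case (insert a A)
    then obtain r where r: "r > 0" "\<forall>k\<in>A. \<exists>M. analytic_bound m x r M (g k)" by auto
    from insert.prems[of a] obtain s M where "s > 0" "analytic_bound m x s M (g a)"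
      unfolding real_analytic_at_def by auto
    with r show ?case
      by (intro exI[of _ "min r s"]) (auto, meson analytic_bound_shrink min.cobounded2 min_less_iff_conj,
        meson analytic_bound_shrink min.cobounded1 min_less_iff_conj)
  qed (auto intro: exI[of _ 1])
  thus ?thesis using that by metis
qed

lemma pcompose_monom: "pcompose (monom c n) q = smult c (q ^ n)"
  by (induction n) (simp_all add: monom_0 monom_Suc pcompose_pCons)

text \<open>
  Shifting the root to \<open>0\<close> gives a polynomial \<open>G\<close> whose coefficients at the base point are \<open>0\<close> in
  degree \<open>0\<close> and \<open>d \<noteq> 0\<close> in degree \<open>1\<close>. The Newton step with frozen derivative,
  \<open>v \<mapsto> v - G(v) / d\<close>, then has coefficients of degree at most \<open>1\<close> that vanish at the base point,
  so they become small on a small polydisc, while the coefficients of higher degree contribute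
  little because \<open>v\<close> is small. This makes the step a contraction.
\<close>
lemma real_analytic_at_simple_root:
  fixes F :: "(nat \<Rightarrow> real) \<Rightarrow> real poly"
  assumes x: "x \<in> Rvec m" and F: "\<And>k. real_analytic_at m x (\<lambda>y. coeff (F y) k)"
    and deg: "\<And>y. degree (F y) \<le> n"
    and root: "poly (F x) \<tau> = 0" and simple: "poly (pderiv (F x)) \<tau> \<noteq> 0"
  obtains t where "real_analytic_at m x t" "t x = \<tau>"
    "eventually (\<lambda>y. poly (F y) (t y) = 0) (near m x)"
proof -
  define G where "G y = pcompose (F y) [:\<tau>, 1:]" for y
  have degG: "degree (G y) \<le> n" for y
    using deg[of y] by (simp add: G_def degree_pcompose)
  have coeffG: "coeff (G y) k = (\<Sum>i\<le>n. coeff (F y) i * coeff ([:\<tau>, 1:] ^ i) k)" for y k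
  proof -
    have "F y = (\<Sum>i\<le>n. monom (coeff (F y) i) i)"
      using poly_as_sum_of_monoms'[OF deg[of y]] by simp
    also have "pcompose \<dots> [:\<tau>, 1:] = (\<Sum>i\<le>n. smult (coeff (F y) i) ([:\<tau>, 1:] ^ i))"
      by (simp add: pcompose_sum pcompose_monom)
    finally show ?thesis by (simp add: G_def coeff_sum)
  qed
  have anG: "real_analytic_at m x (\<lambda>y. coeff (G y) k)" for k
    unfolding coeffG
    by (intro real_analytic_at_sum real_analytic_at_mult F real_analytic_at_const)
  define d where "d = coeff (G x) 1"
  have "poly (pderiv (G x)) 0 = poly (pderiv (F x)) \<tau>"
    by (simp add: G_def pderiv_pcompose poly_pcompose pderiv_pCons)
  hence d: "d \<noteq> 0"
    using simple by (simp add: d_def poly_0_coeff_0 coeff_pderiv)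
  define g where "g k y = (if k = 1 then 1 else 0) - coeff (G y) k / d" for k y
  have g: "real_analytic_at m x (g k)" for k
    unfolding g_def divide_inverse
    by (intro real_analytic_at_diff real_analytic_at_mult anG real_analytic_at_const)
  have g0: "g 0 x = 0" "g 1 x = 0"
    using root d by (auto simp: g_def d_def G_def)
  obtain R M where R: "R > 0" and M: "\<And>k. k \<le> Suc n \<Longrightarrow> analytic_bound m x R (M k) (g k)"
    using real_analytic_at_uniform[of "{..Suc n}" m x g] g by auto
  have Mpos: "M k \<ge> 0" if "k \<le> Suc n" for k
    using analytic_bound_nonneg[OF M[OF that]] R by simp
  (* B bounds the Lipschitz constants of the terms of degree at least 2, up to the factor delta;
     delta is chosen first, to make their contribution at most 1/4, and then the radius s, to bring
     the terms of degree 0 and 1 down to delta / 4. *)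
  define B where "B = (\<Sum>k\<le>Suc n. M k * of_nat k)"
  have B: "B \<ge> 0" unfolding B_def by (intro sum_nonneg) (use Mpos in auto)
  define \<delta> where "\<delta> = 1 / (4 * (1 + B))"
  have \<delta>: "0 < \<delta>" "\<delta> \<le> 1" "B * \<delta> \<le> 1 / 4"
    using B by (auto simp: \<delta>_def field_simps)
  define K where "K = 1 + M 0 + M 1"
  have K: "K > 0" "M 0 \<le> K" "M 1 \<le> K" using Mpos[of 0] Mpos[of 1] by (auto simp: K_def)
  define s where "s = min R (R * (\<delta> / (4 * K)))"
  have s: "0 < s" "s \<le> R" using R \<delta> K by (auto simp: s_def)
  have sM: "s / R * M k \<le> \<delta> / 4" if "k \<le> 1" for k
  proof -
    have "s \<le> \<delta> / (4 * K) * R" by (simp add: s_def mult_ac)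
    hence "s / R \<le> \<delta> / (4 * K)" using pos_divide_le_eq[OF R] by blast
    moreover have "0 \<le> M k" "M k \<le> K" using that K Mpos[of k] by (cases k; simp)+
    ultimately have "s / R * M k \<le> \<delta> / (4 * K) * K"
      using K \<delta> by (intro mult_mono) auto
    thus ?thesis using K by simp
  qed
  define N where "N k = (if k \<le> 1 then s / R * M k else M k)" for k
  have bound: "analytic_bound m x s (N k) (g k)" if "k \<le> Suc n" for k
  proof (cases "k \<le> 1")
    case True
    hence "g k x = 0" using g0 by (auto simp: le_Suc_eq)
    with True analytic_bound_shrink_diff[OF M[OF that] s x] show ?thesis by (simp add: N_def)
  next
    case False
    thus ?thesis using analytic_bound_shrink[OF M[OF that] s] by (simp add: N_def)
  qed
  have sumN: "(\<Sum>k\<le>Suc n. N k * (of_nat k * \<delta> ^ (k - 1))) \<le> 1 / 2"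
  proof -
    have "(\<Sum>k\<le>Suc n. N k * (of_nat k * \<delta> ^ (k - 1)))
        \<le> (\<Sum>k\<le>Suc n. (if k = 1 then \<delta> / 4 else 0) + M k * of_nat k * \<delta>)"
    proof (rule sum_mono)
      fix k assume "k \<in> {..Suc n}"
      hence Mk: "M k \<ge> 0" using Mpos by simp
      consider "k = 0" | "k = 1" | j where "k = Suc (Suc j)"
        by (metis One_nat_def old.nat.exhaust)
      thus "N k * (of_nat k * \<delta> ^ (k - 1)) \<le> (if k = 1 then \<delta> / 4 else 0) + M k * of_nat k * \<delta>"
      proof cases
        case 2
        thus ?thesis using sM[of 1] \<delta> Mk by (simp add: N_def add_increasing2)
      next
        case 3
        have "\<delta> ^ (k - 1) \<le> \<delta>"
          using 3 \<delta> by (simp add: mult_left_le power_le_one)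
        hence "M k * of_nat k * \<delta> ^ (k - 1) \<le> M k * of_nat k * \<delta>"
          using Mk by (intro mult_left_mono) auto
        thus ?thesis using 3 by (simp add: N_def mult_ac)
      qed auto
    qed
    also have "\<dots> = \<delta> / 4 + B * \<delta>"
      by (simp only: sum.distrib sum_distrib_right B_def) simp
    also have "\<dots> \<le> 1 / 2" using \<delta> by linarith
    finally show ?thesis .
  qed
  have "N 0 \<le> \<delta> / 4" using sM[of 0] by (simp add: N_def)
  hence N0: "N 0 \<le> \<delta> / 2" using \<delta> by linarith
  obtain v where v: "analytic_bound m x s \<delta> v"
    "\<And>y. y \<in> polydisc m x s \<Longrightarrow> v y = (\<Sum>k\<le>Suc n. g k y * v y ^ k)"
    "\<And>y. g 0 y = 0 \<Longrightarrow> v y = 0"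
    using analytic_fixed_point[OF s(1) bound N0 sumN] by blast
  have pG: "poly (F y) (\<tau> + v y) = 0" if "y \<in> polydisc m x s" for y
  proof -
    have "poly (G y) (v y) = (\<Sum>k\<le>Suc n. coeff (G y) k * v y ^ k)"
      unfolding poly_altdef
      by (rule sum.mono_neutral_left) (use degG[of y] in \<open>auto simp: coeff_eq_0\<close>)
    moreover have "(\<Sum>k\<le>Suc n. g k y * v y ^ k) =
        (\<Sum>k\<le>Suc n. if k = 1 then v y else 0) - (\<Sum>k\<le>Suc n. coeff (G y) k * v y ^ k) / d"
      unfolding sum_divide_distrib sum_subtractf[symmetric]
      by (rule sum.cong) (auto simp: g_def algebra_simps)
    moreover have "(\<Sum>k\<le>Suc n. if k = 1 then v y else 0) = v y" by simp
    ultimately have "v y = v y - poly (G y) (v y) / d" using v(2)[OF that] by simp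
    hence "poly (G y) (v y) = 0" using d by simp
    thus ?thesis by (simp add: G_def poly_pcompose)
  qed
  show ?thesis
  proof
    have "real_analytic_at m x v" unfolding real_analytic_at_def using v(1) s by blast
    thus "real_analytic_at m x (\<lambda>y. \<tau> + v y)"
      by (intro real_analytic_at_add real_analytic_at_const)
    show "\<tau> + v x = \<tau>" using v(3) g0 by simp
    show "eventually (\<lambda>y. poly (F y) (\<tau> + v y) = 0) (near m x)"
      unfolding eventually_near using pG s by blast
  qed
qed

text \<open>
  The reciprocal of \<open>g\<close> is the simple root of the linear polynomial \<open>g t - 1\<close>.
\<close>
lemma real_analytic_at_divide:
  assumes f: "real_analytic_at m x f" and g: "real_analytic_at m x g" and x: "x \<in> Rvec m" "g x \<noteq> 0"
  shows "real_analytic_at m x (\<lambda>y. f y / g y)"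
proof -
  have an: "real_analytic_at m x (\<lambda>y. coeff [:-1, g y:] k)" for k
    by (intro real_analytic_at_coeff_pCons g) (simp_all add: real_analytic_at_const)
  obtain t where t: "real_analytic_at m x t" "eventually (\<lambda>y. poly [:-1, g y:] (t y) = 0) (near m x)"
    by (rule real_analytic_at_simple_root[OF x(1) an, of 1 "1 / g x"]) (use x in \<open>auto simp: pderiv_pCons\<close>)
  have "eventually (\<lambda>y. f y * t y = f y / g y) (near m x)"
    using t(2) real_analytic_at_near_neq[OF g x] by eventually_elim (simp add: field_simps)
  thus ?thesis by (rule real_analytic_at_cong[OF real_analytic_at_mult[OF f t(1)]])
qed

text \<open>
  The square root of \<open>f\<close> is the positive root of \<open>t\<^sup>2 - f\<close>, which is simple because \<open>f x > 0\<close>.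
\<close>
lemma real_analytic_at_sqrt:
  assumes f: "real_analytic_at m x f" and x: "x \<in> Rvec m" "f x > 0"
  shows "real_analytic_at m x (\<lambda>y. sqrt (f y))"
proof -
  have an: "real_analytic_at m x (\<lambda>y. coeff [:- f y, 0, 1:] k)" for k
    by (intro real_analytic_at_coeff_pCons real_analytic_at_uminus f)
       (simp_all add: real_analytic_at_const)
  obtain t where t: "real_analytic_at m x t" "t x = sqrt (f x)"
    "eventually (\<lambda>y. poly [:- f y, 0, 1:] (t y) = 0) (near m x)"
    by (rule real_analytic_at_simple_root[OF x(1) an, of 2 "sqrt (f x)"])
       (use x in \<open>auto simp: pderiv_pCons\<close>)
  have "t x > 0" using t(2) x by simp
  have "eventually (\<lambda>y. t y = sqrt (f y)) (near m x)"
    using t(3) real_analytic_at_near_pos[OF t(1) x(1) \<open>t x > 0\<close>]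
    by eventually_elim (simp add: power2_eq_square real_sqrt_unique[symmetric])
  thus ?thesis by (rule real_analytic_at_cong[OF t(1)])
qed

text \<open>
  Running a term with \<open>Sqrt\<close> can succeed at a zero of the radicand, where analyticity fails. For
  terms without \<open>Sqrt\<close>, success alone implies analyticity.
\<close>
primrec sqrt_free :: "real_alg \<Rightarrow> bool" where
  "sqrt_free (Input i) = True"
| "sqrt_free (Const c) = True"
| "sqrt_free (Add s t) = (sqrt_free s \<and> sqrt_free t)"
| "sqrt_free (Sub s t) = (sqrt_free s \<and> sqrt_free t)"
| "sqrt_free (Mul s t) = (sqrt_free s \<and> sqrt_free t)"
| "sqrt_free (Div s t) = (sqrt_free s \<and> sqrt_free t)"
| "sqrt_free (Sqrt s) = False"

lemma run_alg_analytic: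
  assumes x: "x \<in> Rvec m" and "sqrt_free t" "run_alg x t = Some u"
  shows "\<exists>g. real_analytic_at m x g \<and> g x = u \<and> eventually (\<lambda>y. run_alg y t = Some (g y)) (near m x)"
  using assms(2,3)
proof (induction t arbitrary: u)
  case (Input i)
  thus ?case by (intro exI[of _ "\<lambda>y. y i"]) (auto intro: real_analytic_at_coordinate)
next
  case (Const c)
  thus ?case by (intro exI[of _ "\<lambda>y. of_rat c"]) (auto intro: real_analytic_at_const)
next
  case (Add s t)
  then obtain u1 u2 where u: "run_alg x s = Some u1" "run_alg x t = Some u2" "u = u1 + u2"
    by (auto simp: bind_eq_Some_conv)
  from Add u obtain g1 g2 where
    g1: "real_analytic_at m x g1" "g1 x = u1" "eventually (\<lambda>y. run_alg y s = Some (g1 y)) (near m x)" and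
    g2: "real_analytic_at m x g2" "g2 x = u2" "eventually (\<lambda>y. run_alg y t = Some (g2 y)) (near m x)"
    by fastforce
  have "eventually (\<lambda>y. run_alg y (Add s t) = Some (g1 y + g2 y)) (near m x)"
    using g1(3) g2(3) by eventually_elim simp
  with g1 g2 u show ?case by (intro exI[of _ "\<lambda>y. g1 y + g2 y"]) (auto intro: real_analytic_at_add)
next
  case (Sub s t)
  then obtain u1 u2 where u: "run_alg x s = Some u1" "run_alg x t = Some u2" "u = u1 - u2"
    by (auto simp: bind_eq_Some_conv)
  from Sub u obtain g1 g2 where
    g1: "real_analytic_at m x g1" "g1 x = u1" "eventually (\<lambda>y. run_alg y s = Some (g1 y)) (near m x)" and
    g2: "real_analytic_at m x g2" "g2 x = u2" "eventually (\<lambda>y. run_alg y t = Some (g2 y)) (near m x)"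
    by fastforce
  have "eventually (\<lambda>y. run_alg y (Sub s t) = Some (g1 y - g2 y)) (near m x)"
    using g1(3) g2(3) by eventually_elim simp
  with g1 g2 u show ?case by (intro exI[of _ "\<lambda>y. g1 y - g2 y"]) (auto intro: real_analytic_at_diff)
next
  case (Mul s t)
  then obtain u1 u2 where u: "run_alg x s = Some u1" "run_alg x t = Some u2" "u = u1 * u2"
    by (auto simp: bind_eq_Some_conv)
  from Mul u obtain g1 g2 where
    g1: "real_analytic_at m x g1" "g1 x = u1" "eventually (\<lambda>y. run_alg y s = Some (g1 y)) (near m x)" and
    g2: "real_analytic_at m x g2" "g2 x = u2" "eventually (\<lambda>y. run_alg y t = Some (g2 y)) (near m x)"
    by fastforce
  have "eventually (\<lambda>y. run_alg y (Mul s t) = Some (g1 y * g2 y)) (near m x)"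
    using g1(3) g2(3) by eventually_elim simp
  with g1 g2 u show ?case by (intro exI[of _ "\<lambda>y. g1 y * g2 y"]) (auto intro: real_analytic_at_mult)
next
  case (Div s t)
  then obtain u1 u2 where u: "run_alg x s = Some u1" "run_alg x t = Some u2" "u = u1 / u2" "u2 \<noteq> 0"
    by (auto simp: bind_eq_Some_conv split: if_splits)
  from Div u obtain g1 g2 where
    g1: "real_analytic_at m x g1" "g1 x = u1" "eventually (\<lambda>y. run_alg y s = Some (g1 y)) (near m x)" and
    g2: "real_analytic_at m x g2" "g2 x = u2" "eventually (\<lambda>y. run_alg y t = Some (g2 y)) (near m x)"
    by fastforce
  have g2x: "g2 x \<noteq> 0" using g2 u by simp
  have "eventually (\<lambda>y. run_alg y (Div s t) = Some (g1 y / g2 y)) (near m x)"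
    using g1(3) g2(3) real_analytic_at_near_neq[OF g2(1) x g2x] by eventually_elim simp
  with g1 g2 u show ?case
    by (intro exI[of _ "\<lambda>y. g1 y / g2 y"]) (auto intro: real_analytic_at_divide x)
qed auto

section \<open>Interlacing polynomials\<close>

definition rootprod :: "nat \<Rightarrow> (nat \<Rightarrow> real) \<Rightarrow> real poly" where
  "rootprod k x = (\<Prod>i=1..k. [:- x i, 1:])"

lemma rootprod_0 [simp]: "rootprod 0 x = 1"
  by (simp add: rootprod_def)

lemma rootprod_Suc: "rootprod (Suc k) x = [:- x (Suc k), 1:] * rootprod k x"
  by (simp add: rootprod_def)

lemma poly_rootprod: "poly (rootprod k x) t = (\<Prod>i=1..k. t - x i)"
  by (simp add: rootprod_def poly_prod)

lemma lead_coeff_rootprod [simp]: "lead_coeff (rootprod k x) = 1"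
  by (simp add: rootprod_def lead_coeff_prod)

lemma degree_rootprod [simp]: "degree (rootprod k x) = k"
  unfolding rootprod_def by (subst degree_prod_eq_sum_degree) auto

lemma coeff_rootprod_top [simp]: "coeff (rootprod k x) k = 1"
  using lead_coeff_rootprod[of k x] by simp

lemma coeff_rootprod_above [simp]: "i > k \<Longrightarrow> coeff (rootprod k x) i = 0"
  by (simp add: coeff_eq_0)

text \<open>
  The \<open>k - j\<close> roots to the right of \<open>t\<close> contribute the negative factors.
\<close>
lemma rootprod_sign:
  assumes "j \<le> k" "\<And>i. i \<in> {1..j} \<Longrightarrow> x i < t" "\<And>i. i \<in> {j<..k} \<Longrightarrow> t < x i"
  shows "(-1) ^ (k - j) * poly (rootprod k x) t > 0"
  using assms(1,3)
proof (induction k rule: dec_induct)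
  case base
  show ?case using assms(2) by (auto simp: poly_rootprod intro!: prod_pos)
next
  case (step n)
  have "(-1) ^ (n - j) * poly (rootprod n x) t > 0" by (rule step.IH) (use step in auto)
  moreover have "t - x (Suc n) < 0" using step.prems[of "Suc n"] step.hyps by simp
  ultimately have "(t - x (Suc n)) * ((-1) ^ (n - j) * poly (rootprod n x) t) < 0"
    by (rule mult_neg_pos[rotated])
  thus ?case using step.hyps by (simp add: rootprod_Suc Suc_diff_le algebra_simps)
qed

lemma opposite_signs:
  fixes u v :: real
  assumes "(-1) ^ n * u > 0" "(-1) ^ n * v < 0"
  shows "u * v < 0"
  using assms by (cases "even n") (auto simp: mult_less_0_iff)

lemma strict_mono_on_atLeastAtMostI:
  fixes y :: "nat \<Rightarrow> real"
  assumes "\<And>i. 1 \<le> i \<Longrightarrow> i < n \<Longrightarrow> y i < y (Suc i)"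
  shows "strict_mono_on {1..n} y"
proof (rule strict_mono_onI)
  fix r s assume rs: "r \<in> {1..n}" "s \<in> {1..n}" "r < s"
  from \<open>r < s\<close> have "Suc r \<le> s" by simp
  thus "y r < y s" using rs(2)
  proof (induction s rule: dec_induct)
    case base
    thus ?case using assms[of r] rs by simp
  next
    case (step s)
    thus ?case using assms[of s] rs by force
  qed
qed

lemma poly_eq_0_of_many_roots:
  fixes g :: "real poly"
  assumes "\<And>i. i \<ge> n \<Longrightarrow> coeff g i = 0" "inj_on y {1..n}" "\<And>i. i \<in> {1..n} \<Longrightarrow> poly g (y i) = 0"
  shows "g = 0"
proof (rule ccontr)
  assume "g \<noteq> 0"
  hence "degree g < n" using assms(1)[of "degree g"] by (metis leading_coeff_neq_0 not_le)
  moreover have "card (y ` {1..n}) \<le> card {t. poly g t = 0}"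
    by (rule card_mono) (use assms(3) \<open>g \<noteq> 0\<close> poly_roots_finite in auto)
  moreover have "card (y ` {1..n}) = n" using card_image[OF assms(2)] by simp
  moreover have "card {t. poly g t = 0} \<le> degree g" using poly_roots_degree[OF \<open>g \<noteq> 0\<close>] .
  ultimately show False by simp
qed

text \<open>
  The intermediate value theorem finds a root in each of \<open>n\<close> consecutive intervals, and a
  polynomial of degree at most \<open>n\<close> has no others. This is how every factorization below arises.
\<close>
lemma rootprod_of_sign_changes:
  fixes f :: "real poly"
  assumes deg: "degree f \<le> n"
    and lu: "\<And>i. i \<in> {1..n} \<Longrightarrow> l i < u i"
    and sign: "\<And>i. i \<in> {1..n} \<Longrightarrow> poly f (l i) * poly f (u i) < 0"
    and ul: "\<And>i. 1 \<le> i \<Longrightarrow> i < n \<Longrightarrow> u i \<le> l (Suc i)"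
  obtains y where "strict_mono_on {1..n} y" "\<And>i. i \<in> {1..n} \<Longrightarrow> l i < y i \<and> y i < u i"
    "f = smult (coeff f n) (rootprod n y)"
proof -
  have "\<exists>t. l i < t \<and> t < u i \<and> poly f t = 0" if "i \<in> {1..n}" for i
    using poly_IVT[OF lu[OF that] sign[OF that]] by auto
  then obtain y where y: "\<And>i. i \<in> {1..n} \<Longrightarrow> l i < y i \<and> y i < u i \<and> poly f (y i) = 0"
    by metis
  have mono: "strict_mono_on {1..n} y"
  proof (rule strict_mono_on_atLeastAtMostI)
    fix i assume i: "1 \<le> i" "i < n"
    thus "y i < y (Suc i)" using y[of i] y[of "Suc i"] ul[of i] by auto
  qed
  have "f - smult (coeff f n) (rootprod n y) = 0"
  proof (rule poly_eq_0_of_many_roots)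
    show "coeff (f - smult (coeff f n) (rootprod n y)) i = 0" if "i \<ge> n" for i
      using that deg by (cases "i = n") (auto simp: coeff_eq_0)
    show "inj_on y {1..n}" using mono by (rule strict_mono_on_imp_inj_on)
    show "poly (f - smult (coeff f n) (rootprod n y)) (y i) = 0" if "i \<in> {1..n}" for i
      using y[OF that] that by (auto simp: poly_rootprod)
  qed
  thus ?thesis using that[OF mono] y by simp
qed

lemma rootprod_of_alternation:
  fixes f :: "real poly"
  assumes deg: "degree f \<le> n"
    and z: "\<And>i. i < n \<Longrightarrow> z i < z (Suc i)"
    and sign: "\<And>i. i \<le> n \<Longrightarrow> (-1) ^ (n - i) * poly f (z i) > 0"
  obtains y where "strict_mono_on {1..n} y" "\<And>i. i \<in> {1..n} \<Longrightarrow> z (i - 1) < y i \<and> y i < z i"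
    "f = smult (coeff f n) (rootprod n y)"
proof -
  have lt: "z (i - 1) < z i" and ch: "poly f (z (i - 1)) * poly f (z i) < 0" if i: "i \<in> {1..n}" for i
  proof -
    have "i - 1 < n" using i by auto
    from z[OF this] show "z (i - 1) < z i" using i by simp
    have "n - (i - 1) = Suc (n - i)" using i by auto
    hence "(-1) ^ (n - i) * poly f (z (i - 1)) < 0" "(-1) ^ (n - i) * poly f (z i) > 0"
      using sign[of i] sign[of "i - 1"] i by auto
    from opposite_signs[OF this(2,1)] show "poly f (z (i - 1)) * poly f (z i) < 0"
      by (simp add: mult.commute)
  qed
  have le: "z i \<le> z (Suc i - 1)" if "1 \<le> i" "i < n" for i by simp
  show ?thesis
    by (rule rootprod_of_sign_changes[where f = f and n = n and l = "\<lambda>i. z (i - 1)" and u = z,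
          OF deg lt ch le that])
qed

lemma monic_sign_right:
  fixes f :: "real poly"
  assumes "lead_coeff f = 1"
  obtains U where "\<And>t. t \<ge> U \<Longrightarrow> poly f t > 0"
proof -
  obtain U where "\<forall>t\<ge>U. poly f t \<ge> lead_coeff f"
    using poly_pinfty_gt_lc[of f] assms by auto
  hence "\<And>t. t \<ge> U \<Longrightarrow> poly f t > 0" using assms by fastforce
  thus ?thesis by (rule that)
qed

lemma monic_sign_left:
  fixes f :: "real poly"
  assumes "lead_coeff f = 1" "degree f = n"
  obtains L where "\<And>t. t \<le> L \<Longrightarrow> (-1) ^ n * poly f t > 0"
proof -
  define g where "g = smult ((-1) ^ n) (pcompose f [:0, -1:])"
  have "lead_coeff (pcompose f [:0, -1:]) = (-1) ^ n"
    using lead_coeff_comp[of "[:0, -1:]" f] assms by simp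
  hence "lead_coeff g = 1"
    by (simp only: g_def lead_coeff_smult) (simp flip: power_mult_distrib)
  then obtain U where U: "\<And>t. t \<ge> U \<Longrightarrow> poly g t > 0" using monic_sign_right by blast
  have "(-1) ^ n * poly f t > 0" if "t \<le> - U" for t
    using U[of "- t"] that by (simp add: g_def poly_pcompose)
  thus ?thesis by (rule that)
qed

text \<open>
  The pair consisting of \<open>rootprod k x\<close> and \<open>B\<close> interlaces: \<open>B\<close> has smaller degree and
  alternates in sign along the roots, starting with a positive value at the largest one. For
  \<open>k = 0\<close> the degree condition forces \<open>B = 0\<close>.
\<close>
definition interlacing :: "nat \<Rightarrow> (nat \<Rightarrow> real) \<Rightarrow> real poly \<Rightarrow> bool" where
  "interlacing k x B \<longleftrightarrow> strict_mono_on {1..k} x \<and> (\<forall>i\<ge>k. coeff B i = 0) \<and>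
     (\<forall>i\<in>{1..k}. (-1) ^ (k - i) * poly B (x i) > 0)"

lemma interlacing_less: "interlacing k x B \<Longrightarrow> 1 \<le> i \<Longrightarrow> i < j \<Longrightarrow> j \<le> k \<Longrightarrow> x i < x j"
  by (auto simp: interlacing_def strict_mono_on_def)

lemma interlacing_sign:
  "interlacing k x B \<Longrightarrow> 1 \<le> i \<Longrightarrow> i \<le> k \<Longrightarrow> (-1) ^ (k - i) * poly B (x i) > 0"
  by (simp add: interlacing_def)

text \<open>
  Put \<open>A = (t - b) rootprod k x - B\<close>. At the old roots \<open>A = - B\<close>, which alternates; the behaviour of
  a monic polynomial at \<open>\<plusminus>\<infinity>\<close> provides one more sign at each end. So \<open>A\<close> has \<open>k + 1\<close> roots
  separated by the old ones, and \<open>rootprod k x\<close> alternates along them.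
\<close>
lemma interlacing_up:
  assumes B: "interlacing k x B" and "\<gamma> > 0"
  obtains z where "[:- b, 1:] * rootprod k x - B = rootprod (Suc k) z"
    "interlacing (Suc k) z (smult \<gamma> (rootprod k x))"
proof -
  define A where "A = [:- b, 1:] * rootprod k x - B"
  have coeffA: "coeff A i = (if i = Suc k then 1 else 0)" if "i > k" for i
    using that B by (cases i) (auto simp: A_def interlacing_def coeff_pCons)
  have degA: "degree A = Suc k"
    using coeffA by (intro antisym degree_le le_degree) auto
  have lcA: "lead_coeff A = 1" using coeffA[of "Suc k"] by (simp add: degA)
  obtain U where U: "\<And>t. t \<ge> U \<Longrightarrow> poly A t > 0" using monic_sign_right[OF lcA] by blast
  obtain L where L: "\<And>t. t \<le> L \<Longrightarrow> (-1) ^ Suc k * poly A t > 0" using monic_sign_left[OF lcA degA] by blast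
  define L' where "L' = min L (x 1 - 1)"
  define U' where "U' = max (max U (x k + 1)) (L' + 1)"
  define p where "p i = (if i = 0 then L' else if i = Suc k then U' else x i)" for i
  have xm: "x i < x j" if "1 \<le> i" "i < j" "j \<le> k" for i j
    using interlacing_less[OF B that] .
  have p: "p i < p (Suc i)" if "i < Suc k" for i
    using that xm[of i "Suc i"] by (auto simp: p_def L'_def U'_def)
  have psign: "(-1) ^ (Suc k - i) * poly A (p i) > 0" if "i \<le> Suc k" for i
  proof -
    consider "i = 0" | "i = Suc k" | "i \<in> {1..k}" using \<open>i \<le> Suc k\<close> by fastforce
    thus ?thesis
    proof cases
      case 1 thus ?thesis using L[of L'] by (simp add: p_def L'_def)
    next
      case 2 thus ?thesis using U[of U'] by (simp add: p_def U'_def)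
    next
      case 3
      hence "poly (rootprod k x) (x i) = 0" by (auto simp: poly_rootprod)
      hence "poly A (p i) = - poly B (x i)" using 3 by (simp add: A_def p_def)
      thus ?thesis using B 3 by (auto simp: interlacing_def Suc_diff_le)
    qed
  qed
  obtain z where z: "strict_mono_on {1..Suc k} z" "\<And>i. i \<in> {1..Suc k} \<Longrightarrow> p (i - 1) < z i \<and> z i < p i"
    "A = smult (coeff A (Suc k)) (rootprod (Suc k) z)"
    by (rule rootprod_of_alternation[where f = A and n = "Suc k" and z = p, OF _ p psign])
       (simp_all only: degA order_refl)
  have pm: "p i \<le> p j" if "i \<le> j" "j \<le> Suc k" for i j
    using that
  proof (induction j rule: dec_induct)
    case (step j) thus ?case using p[of j] by simp
  qed simp
  have "interlacing (Suc k) z (smult \<gamma> (rootprod k x))"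
    unfolding interlacing_def
  proof (intro conjI ballI z(1) allI impI)
    fix i assume i: "i \<in> {1..Suc k}"
    have "(-1) ^ (k - (i - 1)) * poly (rootprod k x) (z i) > 0"
    proof (rule rootprod_sign)
      fix j assume j: "j \<in> {1..i - 1}"
      hence "x j = p j" using i by (auto simp: p_def)
      thus "x j < z i" using z(2)[OF i] pm[of j "i - 1"] i j by fastforce
    next
      fix j assume j: "j \<in> {i - 1<..k}"
      hence "x j = p j" using i by (auto simp: p_def)
      thus "z i < x j" using z(2)[OF i] pm[of i j] i j by fastforce
    qed (use i in auto)
    thus "(-1) ^ (Suc k - i) * poly (smult \<gamma> (rootprod k x)) (z i) > 0"
      using i \<open>\<gamma> > 0\<close> by (simp add: mult.left_commute[of _ \<gamma>] Suc_diff_le[symmetric])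
  qed auto
  moreover have "A = rootprod (Suc k) z" using z(3) coeffA[of "Suc k"] by simp
  ultimately show ?thesis using that by (simp add: A_def)
qed

text \<open>
  One step of Euclid's algorithm inverts the recurrence. The alternation of \<open>B\<close> along the
  \<open>k + 1\<close> roots of \<open>A\<close> exhausts its degree, so its roots separate those of \<open>A\<close>, and \<open>\<beta> > 0\<close>
  because \<open>B\<close> is positive to the right of them. At the roots of \<open>B\<close> the remainder equals \<open>- A\<close>,
  which alternates. The constant \<open>b\<close> is the one that cancels the coefficient of degree \<open>k\<close>.
\<close>
lemma interlacing_down:
  fixes k x B defines "A \<equiv> rootprod (Suc k) x"
  assumes B: "interlacing (Suc k) x B"
  defines "\<beta> \<equiv> coeff B k"
  defines "b \<equiv> coeff (pCons 0 (smult (1 / \<beta>) B)) k - coeff A k"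
  obtains y where "\<beta> > 0" "B = smult \<beta> (rootprod k y)"
    "interlacing k y ([:- b, 1:] * rootprod k y - A)"
proof -
  have degB: "degree B \<le> k" using B by (intro degree_le) (auto simp: interlacing_def)
  have xm: "x i < x j" if "1 \<le> i" "i < j" "j \<le> Suc k" for i j
    using interlacing_less[OF B that] .
  have sB: "(-1) ^ (k - i) * poly B (x (Suc i)) > 0" if "i \<le> k" for i
    using interlacing_sign[OF B, of "Suc i"] that by simp
  have xS: "x (Suc i) < x (Suc (Suc i))" if "i < k" for i using xm that by simp
  obtain y where y: "strict_mono_on {1..k} y" "\<And>i. i \<in> {1..k} \<Longrightarrow> x (Suc (i - 1)) < y i \<and> y i < x (Suc i)"
    "B = smult (coeff B k) (rootprod k y)"
    by (rule rootprod_of_alternation[where z = "\<lambda>i. x (Suc i)", OF degB xS sB that])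
  have yB: "B = smult \<beta> (rootprod k y)" using y(3) by (simp only: \<beta>_def)
  have yx: "x i < y i" "y i < x (Suc i)" if "i \<in> {1..k}" for i
    using y(2)[OF that] that by auto
  have "(-1) ^ (k - k) * poly (rootprod k y) (x (Suc k)) > 0"
  proof (rule rootprod_sign)
    fix i assume "i \<in> {1..k}"
    thus "y i < x (Suc k)" using yx(2)[of i] xm[of "Suc i" "Suc k"] by (cases "i = k") auto
  qed auto
  hence "poly (rootprod k y) (x (Suc k)) > 0" by simp
  moreover have "poly B (x (Suc k)) = \<beta> * poly (rootprod k y) (x (Suc k))" by (subst yB) simp
  hence "\<beta> * poly (rootprod k y) (x (Suc k)) > 0" using sB[of k] by simp
  ultimately have \<beta>: "\<beta> > 0" by (simp add: zero_less_mult_iff)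
  have B': "smult (1 / \<beta>) B = rootprod k y" by (subst yB) (use \<beta> in simp)
  have "interlacing k y ([:- b, 1:] * rootprod k y - A)"
    unfolding interlacing_def
  proof (intro conjI ballI y(1) allI impI)
    fix i assume "i \<ge> k"
    then consider "i = k" | "i = Suc k" | "i > Suc k" by linarith
    thus "coeff ([:- b, 1:] * rootprod k y - A) i = 0"
      by cases (auto simp: b_def B' A_def coeff_pCons split: nat.split)
  next
    fix i assume i: "i \<in> {1..k}"
    have "(-1) ^ (Suc k - i) * poly A (y i) > 0"
      unfolding A_def
    proof (rule rootprod_sign)
      fix j assume "j \<in> {1..i}"
      thus "x j < y i" using yx(1)[OF i] xm[of j i] i by (cases "j = i") auto
    next
      fix j assume "j \<in> {i<..Suc k}"
      thus "y i < x j" using yx(2)[OF i] xm[of "Suc i" j] i by (cases "j = Suc i") auto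
    qed (use i in auto)
    moreover have "poly (rootprod k y) (y i) = 0" using i by (auto simp: poly_rootprod)
    ultimately show "(-1) ^ (k - i) * poly ([:- b, 1:] * rootprod k y - A) (y i) > 0"
      using i by (simp add: Suc_diff_le)
  qed
  thus ?thesis by (rule that[OF \<beta> yB])
qed

text \<open>
  The chain \<open>lo 1 < hi 1 < lo 2 < hi 2 < \<dots> < lo k < hi k\<close>.
\<close>
definition interlaced :: "nat \<Rightarrow> (nat \<Rightarrow> real) \<Rightarrow> (nat \<Rightarrow> real) \<Rightarrow> bool" where
  "interlaced k lo hi \<longleftrightarrow> (\<forall>i\<in>{1..k}. lo i < hi i) \<and> (\<forall>i\<in>{1..<k}. hi i < lo (Suc i))"

lemma interlaced_mono:
  assumes "interlaced k lo hi"
  shows "strict_mono_on {1..k} lo" "strict_mono_on {1..k} hi"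
    and "\<And>i j. 1 \<le> i \<Longrightarrow> i \<le> j \<Longrightarrow> j \<le> k \<Longrightarrow> lo i < hi j"
    and "\<And>i j. 1 \<le> i \<Longrightarrow> i < j \<Longrightarrow> j \<le> k \<Longrightarrow> hi i < lo j"
proof -
  have st: "lo i < hi i" "i < k \<Longrightarrow> hi i < lo (Suc i)" if "1 \<le> i" "i \<le> k" for i
    using assms that by (auto simp: interlaced_def)
  show lo: "strict_mono_on {1..k} lo"
  proof (rule strict_mono_on_atLeastAtMostI)
    fix i assume "1 \<le> i" "i < k" thus "lo i < lo (Suc i)" using st[of i] by auto
  qed
  show "strict_mono_on {1..k} hi"
  proof (rule strict_mono_on_atLeastAtMostI)
    fix i assume "1 \<le> i" "i < k" thus "hi i < hi (Suc i)" using st[of i] st[of "Suc i"] by auto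
  qed
  have lo': "lo i \<le> lo j" if "1 \<le> i" "i \<le> j" "j \<le> k" for i j
    using strict_mono_onD[OF lo, of i j] that by (cases "i = j") auto
  show "lo i < hi j" if "1 \<le> i" "i \<le> j" "j \<le> k" for i j
    using lo'[of i j] st[of j] that by auto
  show "hi i < lo j" if "1 \<le> i" "i < j" "j \<le> k" for i j
    using lo'[of "Suc i" j] st(2)[of i] that by auto
qed

text \<open>
  Between consecutive roots \<open>x\<^sub>i < x\<^sub>i\<^sub>+\<^sub>1\<close> of \<open>A\<close> the polynomial \<open>B\<close> has a zero \<open>y\<^sub>i\<close>. At \<open>x\<^sub>i\<close> the
  values of \<open>A \<mp> B\<close> are \<open>\<mp>B\<close>, at \<open>y\<^sub>i\<close> both are \<open>A\<close>. Comparing signs puts one root of \<open>A - B\<close> to the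
  left of \<open>y\<^sub>i\<close> and one root of \<open>A + B\<close> to its right. The points \<open>y\<^sub>i\<close> are needed for the order of
  these two roots, which the signs at the \<open>x\<^sub>i\<close> alone leave open.
\<close>
lemma interlacing_imp_interlaced:
  assumes B: "interlacing k x B"
  obtains lo hi where "interlaced k lo hi" "rootprod k x + B = rootprod k lo" "rootprod k x - B = rootprod k hi"
proof -
  let ?A = "rootprod k x"
  have xm: "x i < x j" if "1 \<le> i" "i < j" "j \<le> k" for i j
    using interlacing_less[OF B that] .
  have sB: "(-1) ^ (k - i) * poly B (x i) > 0" if "i \<in> {1..k}" for i
    using B that by (auto simp: interlacing_def)
  have A0: "poly ?A (x i) = 0" if "i \<in> {1..k}" for i using that by (auto simp: poly_rootprod)
  have coeffB: "coeff B i = 0" if "i \<ge> k" for i using B that by (simp add: interlacing_def)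
  have cD: "coeff (?A + smult c B) i = (if i = k then 1 else 0)" if "i \<ge> k" for i c
    using that coeffB[OF that] by simp
  have deg: "degree (?A + smult c B) = k" for c
    by (intro antisym degree_le le_degree) (simp_all add: coeffB)
  have deg_le: "degree (?A + smult c B) \<le> k" for c by (simp only: deg order_refl)
  have lc: "lead_coeff (?A + smult c B) = 1" for c using cD[of k] by (simp add: deg)
  obtain U0 where U0: "\<And>t. t \<ge> U0 \<Longrightarrow> poly (?A + smult (-1) B) t > 0" using monic_sign_right[OF lc] by blast
  obtain L0 where L0: "\<And>t. t \<le> L0 \<Longrightarrow> (-1) ^ k * poly (?A + smult 1 B) t > 0"
    using monic_sign_left[OF lc deg] by blast
  define U where "U = max U0 (x k + 1)"
  define L where "L = min L0 (x 1 - 1)"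
  have "\<exists>t. x i < t \<and> t < x (Suc i) \<and> poly B t = 0" if "i \<in> {1..<k}" for i
  proof -
    have "poly B (x i) * poly B (x (Suc i)) < 0"
    proof -
      have "(-1) ^ (k - i) * poly B (x (Suc i)) < 0"
        using sB[of "Suc i"] that by (simp flip: Suc_diff_Suc)
      with sB[of i] that show ?thesis by (auto intro: opposite_signs[of "k - i"])
    qed
    thus ?thesis using poly_IVT[OF xm[of i "Suc i"]] that by auto
  qed
  then obtain y where y: "\<And>i. i \<in> {1..<k} \<Longrightarrow> x i < y i \<and> y i < x (Suc i) \<and> poly B (y i) = 0" by metis
  have sA: "(-1) ^ (k - i) * poly ?A (y i) > 0" if "i \<in> {1..<k}" for i
  proof (rule rootprod_sign)
    fix j assume "j \<in> {1..i}"
    thus "x j < y i" using y[OF that] xm[of j i] that by (cases "j = i") auto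
  next
    fix j assume "j \<in> {i<..k}"
    thus "y i < x j" using y[OF that] xm[of "Suc i" j] that by (cases "j = Suc i") auto
  qed (use that in auto)
  (* The zeros of B, completed by far points L and U at both ends, separate all the roots x i. *)
  define p where "p i = (if i = 0 then L else if i = k then U else y i)" for i
  have px: "x i < p i" if "i \<in> {1..k}" for i
    using that y[of i] by (auto simp: p_def U_def)
  have xp: "p (i - 1) < x i" if "i \<in> {1..k}" for i
  proof (cases "i = 1")
    case False
    hence "i - 1 \<in> {1..<k}" "Suc (i - 1) = i" using that by auto
    thus ?thesis using y[of "i - 1"] by (simp add: p_def)
  qed (use that in \<open>simp add: p_def L_def\<close>)
  obtain hi where hi: "strict_mono_on {1..k} hi" "\<And>i. i \<in> {1..k} \<Longrightarrow> x i < hi i \<and> hi i < p i"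
    "?A + smult (-1) B = smult (coeff (?A + smult (-1) B) k) (rootprod k hi)"
  proof (rule rootprod_of_sign_changes[of "?A + smult (-1) B" k x p, OF deg_le _ _ _ that])
    fix i assume i: "i \<in> {1..k}"
    show "x i < p i" by (rule px[OF i])
    have "(-1) ^ (k - i) * poly (?A + smult (-1) B) (p i) > 0"
    proof (cases "i = k")
      case True thus ?thesis using U0[of U] i by (simp add: p_def U_def)
    next
      case False thus ?thesis using y[of i] sA[of i] i by (simp add: p_def)
    qed
    moreover have "(-1) ^ (k - i) * poly (?A + smult (-1) B) (x i) < 0"
      using sB[OF i] A0[OF i] by simp
    ultimately show "poly (?A + smult (-1) B) (x i) * poly (?A + smult (-1) B) (p i) < 0"
      by (subst mult.commute) (rule opposite_signs)
  next
    fix i assume i: "1 \<le> i" "i < k"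
    show "p i \<le> x (Suc i)" using xp[of "Suc i"] i by simp
  qed
  obtain lo where lo: "strict_mono_on {1..k} lo" "\<And>i. i \<in> {1..k} \<Longrightarrow> p (i - 1) < lo i \<and> lo i < x i"
    "?A + smult 1 B = smult (coeff (?A + smult 1 B) k) (rootprod k lo)"
  proof (rule rootprod_of_sign_changes[of "?A + smult 1 B" k "\<lambda>i. p (i - 1)" x, OF deg_le _ _ _ that])
    fix i assume i: "i \<in> {1..k}"
    show "p (i - 1) < x i" by (rule xp[OF i])
    have k: "k - (i - 1) = Suc (k - i)" using i by auto
    have "(-1) ^ (k - (i - 1)) * poly (?A + smult 1 B) (p (i - 1)) > 0"
    proof (cases "i = 1")
      case True thus ?thesis using L0[of L] i by (simp add: p_def L_def)
    next
      case False
      hence "i - 1 \<in> {1..<k}" using i by auto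
      thus ?thesis using y[of "i - 1"] sA[of "i - 1"] i False by (simp add: p_def)
    qed
    hence "(-1) ^ (k - i) * poly (?A + smult 1 B) (p (i - 1)) < 0" unfolding k by simp
    moreover have "(-1) ^ (k - i) * poly (?A + smult 1 B) (x i) > 0"
      using sB[OF i] A0[OF i] by simp
    ultimately show "poly (?A + smult 1 B) (p (i - 1)) * poly (?A + smult 1 B) (x i) < 0"
      by (subst mult.commute) (rule opposite_signs)
  next
    fix i assume i: "1 \<le> i" "i < k"
    show "x i \<le> p (Suc i - 1)" using px[of i] i by simp
  qed
  have "interlaced k lo hi"
    unfolding interlaced_def
  proof (intro conjI ballI)
    fix i assume "i \<in> {1..k}"
    thus "lo i < hi i" using lo(2)[of i] hi(2)[of i] by auto
  next
    fix i assume "i \<in> {1..<k}"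
    thus "hi i < lo (Suc i)" using lo(2)[of "Suc i"] hi(2)[of i] by auto
  qed
  thus ?thesis using that lo(3) hi(3) cD[of k 1] cD[of k "-1"] by simp
qed

text \<open>
  The half sum equals half of one product at each root of the other. Its signs at \<open>lo i\<close> and
  \<open>hi i\<close> are opposite, so it has a root \<open>x i\<close> in between, where the half difference equals
  \<open>rootprod k lo\<close> and hence alternates.
\<close>
lemma interlaced_imp_interlacing:
  assumes "interlaced k lo hi"
  obtains x where "rootprod k x = smult (1/2) (rootprod k lo + rootprod k hi)"
    "interlacing k x (smult (1/2) (rootprod k lo - rootprod k hi))"
proof -
  note m = interlaced_mono[OF assms]
  define A where "A = smult (1/2) (rootprod k lo + rootprod k hi)"
  define B where "B = smult (1/2) (rootprod k lo - rootprod k hi)"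
  have degA: "degree A \<le> k" by (rule degree_le) (simp add: A_def)
  have lom: "lo i < lo j" and him: "hi i < hi j" if "1 \<le> i" "i < j" "j \<le> k" for i j
    using strict_mono_onD[OF m(1), of i j] strict_mono_onD[OF m(2), of i j] that by auto
  obtain x where x: "strict_mono_on {1..k} x" "\<And>i. i \<in> {1..k} \<Longrightarrow> lo i < x i \<and> x i < hi i"
    "A = smult (coeff A k) (rootprod k x)"
  proof (rule rootprod_of_sign_changes[OF degA, of lo hi, OF _ _ _ that])
    fix i assume i: "i \<in> {1..k}"
    show "lo i < hi i" using m(3)[of i i] i by simp
    have k: "k - (i - 1) = Suc (k - i)" using i by auto
    have "(-1) ^ (k - (i - 1)) * poly (rootprod k hi) (lo i) > 0"
    proof (rule rootprod_sign)
      fix j assume "j \<in> {1..i - 1}" thus "hi j < lo i" using m(4)[of j i] i by auto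
    next
      fix j assume "j \<in> {i - 1<..k}" thus "lo i < hi j" using m(3)[of i j] i by auto
    qed (use i in auto)
    moreover have "poly (rootprod k lo) (lo i) = 0" using i by (auto simp: poly_rootprod)
    ultimately have 1: "(-1) ^ (k - i) * poly A (lo i) < 0" unfolding k by (simp add: A_def)
    have "(-1) ^ (k - i) * poly (rootprod k lo) (hi i) > 0"
    proof (rule rootprod_sign)
      fix j assume "j \<in> {1..i}" thus "lo j < hi i" using m(3)[of j i] i by auto
    next
      fix j assume "j \<in> {i<..k}" thus "hi i < lo j" using m(4)[of i j] i by auto
    qed (use i in auto)
    moreover have "poly (rootprod k hi) (hi i) = 0" using i by (auto simp: poly_rootprod)
    ultimately have "(-1) ^ (k - i) * poly A (hi i) > 0" by (simp add: A_def)
    from opposite_signs[OF this 1] show "poly A (lo i) * poly A (hi i) < 0" by (simp add: mult.commute)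
  next
    fix i assume "1 \<le> i" "i < k" thus "hi i \<le> lo (Suc i)" using m(4)[of i "Suc i"] by auto
  qed
  have A: "A = rootprod k x" using x(3) by (simp add: A_def)
  have "interlacing k x B"
    unfolding interlacing_def
  proof (intro conjI x(1) ballI allI impI)
    show "coeff B i = 0" if "i \<ge> k" for i using that by (cases "i = k") (auto simp: B_def)
    fix i assume i: "i \<in> {1..k}"
    have "(-1) ^ (k - i) * poly (rootprod k lo) (x i) > 0"
    proof (rule rootprod_sign)
      fix j assume "j \<in> {1..i}"
      thus "lo j < x i" using lom[of j i] x(2)[OF i] i by (cases "j = i") auto
    next
      fix j assume "j \<in> {i<..k}"
      thus "x i < lo j" using m(4)[of i j] x(2)[OF i] i by auto
    qed (use i in auto)
    moreover have "poly A (x i) = 0" using i unfolding A by (auto simp: poly_rootprod)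
    hence "poly B (x i) = poly (rootprod k lo) (x i)"
      by (simp add: A_def B_def field_simps)
    ultimately show "(-1) ^ (k - i) * poly B (x i) > 0" by simp
  qed
  thus ?thesis using that A by (simp add: A_def B_def)
qed

section \<open>Orthogonal polynomials of a Jacobi matrix\<close>

text \<open>
  The characteristic polynomials of the leading principal submatrices.
\<close>
fun jacobi_poly :: "(nat \<Rightarrow> real) \<Rightarrow> (nat \<Rightarrow> real) \<Rightarrow> nat \<Rightarrow> real poly" where
  "jacobi_poly a b 0 = 1"
| "jacobi_poly a b (Suc 0) = [:- b 1, 1:]"
| "jacobi_poly a b (Suc (Suc k)) =
     [:- b (Suc (Suc k)), 1:] * jacobi_poly a b (Suc k) - smult ((a (Suc k))\<^sup>2) (jacobi_poly a b k)"

text \<open>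
  The subtracted term \<open>a\<^sub>k\<^sup>2 P\<^sub>k\<^sub>-\<^sub>1\<close> of the three-term recurrence, \<open>0\<close> for \<open>k = 0\<close>. It is also the
  polynomial by which the characteristic polynomials of \<open>J\<^sup>\<plusminus>\<close> differ from that of \<open>J\<^sub>p\<close>.
\<close>
fun jacobi_tail :: "(nat \<Rightarrow> real) \<Rightarrow> (nat \<Rightarrow> real) \<Rightarrow> nat \<Rightarrow> real poly" where
  "jacobi_tail a b 0 = 0"
| "jacobi_tail a b (Suc k) = smult ((a (Suc k))\<^sup>2) (jacobi_poly a b k)"

lemma jacobi_poly_Suc:
  "jacobi_poly a b (Suc k) = [:- b (Suc k), 1:] * jacobi_poly a b k - jacobi_tail a b k"
  by (cases k) auto

lemma jacobi_poly_cong: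
  assumes "\<And>i. i \<in> {1..k} \<Longrightarrow> b i = b' i" "\<And>i. i \<in> {1..<k} \<Longrightarrow> a i = a' i"
  shows "jacobi_poly a b k = jacobi_poly a' b' k"
  using assms by (induction a b k rule: jacobi_poly.induct) auto

lemma jacobi_tail_cong:
  assumes "\<And>i. i \<in> {1..k} \<Longrightarrow> b i = b' i" "\<And>i. i \<in> {1..k} \<Longrightarrow> a i = a' i"
  shows "jacobi_tail a b k = jacobi_tail a' b' k"
  using assms by (cases k) (auto intro!: arg_cong2[of _ _ _ _ smult] jacobi_poly_cong)

lemma jacobi_poly_interlacing:
  assumes "\<And>i. i \<in> {1..k} \<Longrightarrow> a i > 0"
  obtains x where "jacobi_poly a b k = rootprod k x" "interlacing k x (jacobi_tail a b k)"
proof -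
  have "\<exists>x. jacobi_poly a b k = rootprod k x \<and> interlacing k x (jacobi_tail a b k)"
    using assms
  proof (induction k)
    case 0
    show ?case by (auto simp: interlacing_def strict_mono_on_def)
  next
    case (Suc k)
    then obtain x where x: "jacobi_poly a b k = rootprod k x" "interlacing k x (jacobi_tail a b k)"
      by force
    have "(a (Suc k))\<^sup>2 > 0" using Suc.prems[of "Suc k"] by simp
    from interlacing_up[OF x(2) this, of "b (Suc k)"] show ?case
      by (metis jacobi_poly_Suc jacobi_tail.simps(2) x(1))
  qed
  thus ?thesis using that by blast
qed

lemma interlacing_imp_jacobi_poly:
  assumes "interlacing k x B"
  obtains a b where "\<And>i. i \<in> {1..k} \<Longrightarrow> a i > 0" "jacobi_poly a b k = rootprod k x" "jacobi_tail a b k = B"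
proof -
  have "\<exists>a b. (\<forall>i\<in>{1..k}. a i > 0) \<and> jacobi_poly a b k = rootprod k x \<and> jacobi_tail a b k = B"
    using assms
  proof (induction k arbitrary: x B)
    case 0
    hence "B = 0" by (auto simp: interlacing_def poly_eq_iff)
    thus ?case by auto
  next
    case (Suc k)
    define c where "c = coeff (pCons 0 (smult (1 / coeff B k) B)) k - coeff (rootprod (Suc k) x) k"
    obtain y where y: "coeff B k > 0" "B = smult (coeff B k) (rootprod k y)"
      "interlacing k y ([:- c, 1:] * rootprod k y - rootprod (Suc k) x)"
      using interlacing_down[OF Suc.prems] unfolding c_def by blast
    from Suc.IH[OF y(3)] obtain a b where ab: "\<forall>i\<in>{1..k}. a i > 0" "jacobi_poly a b k = rootprod k y"
      "jacobi_tail a b k = [:- c, 1:] * rootprod k y - rootprod (Suc k) x" by blast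
    define a' where "a' = a(Suc k := sqrt (coeff B k))"
    define b' where "b' = b(Suc k := c)"
    have 1: "jacobi_poly a' b' k = jacobi_poly a b k" "jacobi_tail a' b' k = jacobi_tail a b k"
      by (auto simp: a'_def b'_def intro!: jacobi_poly_cong jacobi_tail_cong)
    have "jacobi_poly a' b' (Suc k) = rootprod (Suc k) x"
      unfolding jacobi_poly_Suc 1 ab by (simp add: b'_def)
    moreover have "jacobi_tail a' b' (Suc k) = B"
    proof -
      have "jacobi_tail a' b' (Suc k) = smult (coeff B k) (rootprod k y)"
        using y(1) by (simp add: 1 ab(2)) (simp add: a'_def)
      also have "\<dots> = B" by (rule y(2)[symmetric])
      finally show ?thesis .
    qed
    moreover have "\<forall>i\<in>{1..Suc k}. a' i > 0"
      using ab(1) y(1) by (auto simp: a'_def le_Suc_eq)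
    ultimately show ?case by blast
  qed
  thus ?thesis using that by blast
qed

section \<open>Spectra of Jacobi matrices\<close>

lemma jacobi_mat_mult_vec:
  assumes v: "v \<in> carrier_vec p" and i: "i < p"
  shows "(jacobi_mat a b p *\<^sub>v v) $ i =
    (if Suc i < p then a (Suc i) * v $ Suc i else 0) + b (Suc i) * v $ i + (if i = 0 then 0 else a i * v $ (i - 1))"
proof -
  have "(jacobi_mat a b p *\<^sub>v v) $ i = (\<Sum>j<p. jacobi_mat a b p $$ (i, j) * v $ j)"
    using v i by (simp add: jacobi_mat_def scalar_prod_def lessThan_atLeast0)
  also have "\<dots> = (\<Sum>j<p. (if j = Suc i then a (Suc i) * v $ Suc i else 0) + (if j = i then b (Suc i) * v $ i else 0)
      + (if j = i - 1 then (if i = 0 then 0 else a i * v $ (i - 1)) else 0))"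
    using i by (intro sum.cong) (auto simp: jacobi_mat_def)
  also have "\<dots> = (if Suc i < p then a (Suc i) * v $ Suc i else 0) + b (Suc i) * v $ i
      + (if i = 0 then 0 else a i * v $ (i - 1))"
    using i by (simp add: sum.distrib)
  finally show ?thesis .
qed

text \<open>
  All rows but the last of the eigenvalue equation form a recurrence that determines an eigenvector
  up to a factor: its entries are \<open>\<phi> k = P\<^sub>k(\<mu>) / (a\<^sub>1 \<cdots> a\<^sub>k)\<close>. The last row then says that
  \<open>\<psi> (p - 1) = P\<^sub>p(\<mu>) / (a\<^sub>1 \<cdots> a\<^sub>p\<^sub>-\<^sub>1)\<close> vanishes.
\<close>
lemma eigenvalue_jacobi_mat:
  assumes p: "p \<ge> 1" and a: "\<And>i. i \<in> {1..<p} \<Longrightarrow> a i \<noteq> 0"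
  shows "eigenvalue (jacobi_mat a b p) \<mu> \<longleftrightarrow> poly (jacobi_poly a b p) \<mu> = 0"
proof -
  define \<pi> where "\<pi> k = (\<Prod>i=1..k. a i)" for k
  define \<phi> where "\<phi> k = poly (jacobi_poly a b k) \<mu> / \<pi> k" for k
  define \<psi> where "\<psi> k = poly (jacobi_poly a b (Suc k)) \<mu> / \<pi> k" for k
  have \<pi>: "\<pi> k \<noteq> 0" if "k < p" for k
    using a that by (auto simp: \<pi>_def)
  have \<pi>_Suc: "\<pi> (Suc k) = a (Suc k) * \<pi> k" for k by (simp add: \<pi>_def)
  have \<psi>_eq: "\<psi> k = (\<mu> - b (Suc k)) * \<phi> k - (if k = 0 then 0 else a k * \<phi> (k - 1))" if "k < p" for k
  proof (cases k)
    case 0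
    thus ?thesis by (simp add: \<psi>_def \<phi>_def \<pi>_def)
  next
    case (Suc j)
    have "a k \<noteq> 0" using a[of k] that Suc by simp
    thus ?thesis using \<pi>[of k] \<pi>[of j] that Suc
      by (simp add: \<psi>_def \<phi>_def \<pi>_Suc field_simps power2_eq_square)
  qed
  have \<psi>_\<phi>: "\<psi> k = a (Suc k) * \<phi> (Suc k)" if "Suc k < p" for k
    using a[of "Suc k"] that by (simp add: \<psi>_def \<phi>_def \<pi>_Suc)
  have root: "\<psi> (p - 1) = 0 \<longleftrightarrow> poly (jacobi_poly a b p) \<mu> = 0"
    using p \<pi>[of "p - 1"] by (simp add: \<psi>_def)
  show ?thesis
  proof
    assume "eigenvalue (jacobi_mat a b p) \<mu>"
    then obtain v where v: "v \<in> carrier_vec p" "v \<noteq> 0\<^sub>v p" "jacobi_mat a b p *\<^sub>v v = \<mu> \<cdot>\<^sub>v v"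
      by (auto simp: eigenvalue_def eigenvector_def jacobi_mat_def)
    have row: "(if Suc i < p then a (Suc i) * v $ Suc i else 0) =
        (\<mu> - b (Suc i)) * v $ i - (if i = 0 then 0 else a i * v $ (i - 1))" if "i < p" for i
    proof -
      have "(jacobi_mat a b p *\<^sub>v v) $ i = \<mu> * v $ i" using v that by simp
      thus ?thesis unfolding jacobi_mat_mult_vec[OF v(1) that] by (simp add: algebra_simps)
    qed
    have v\<psi>: "v $ 0 * \<psi> i = (if Suc i < p then a (Suc i) * v $ Suc i else 0)"
      if "i < p" "v $ i = v $ 0 * \<phi> i" "i \<noteq> 0 \<Longrightarrow> v $ (i - 1) = v $ 0 * \<phi> (i - 1)" for i
    proof -
      have "v $ 0 * \<psi> i =
          (\<mu> - b (Suc i)) * (v $ 0 * \<phi> i) - (if i = 0 then 0 else a i * (v $ 0 * \<phi> (i - 1)))"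
        unfolding \<psi>_eq[OF that(1)] by (simp add: algebra_simps)
      also have "\<dots> = (\<mu> - b (Suc i)) * v $ i - (if i = 0 then 0 else a i * v $ (i - 1))"
        using that(2)[symmetric] that(3)[symmetric] by simp
      finally show ?thesis using row[OF that(1)] by simp
    qed
    have vphi: "v $ i = v $ 0 * \<phi> i" if "i < p" for i
      using that
    proof (induction i rule: less_induct)
      case (less i)
      show ?case
      proof (cases i)
        case 0
        thus ?thesis by (simp add: \<phi>_def \<pi>_def)
      next
        case (Suc j)
        have 1: "v $ j = v $ 0 * \<phi> j" by (rule less.IH) (use less.prems Suc in auto)
        have 2: "v $ (j - 1) = v $ 0 * \<phi> (j - 1)" if "j \<noteq> 0"
          by (rule less.IH) (use less.prems Suc that in auto)
        have "a (Suc j) * v $ Suc j = v $ 0 * \<psi> j"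
          using v\<psi>[OF _ 1 2] less.prems Suc by simp
        hence "a (Suc j) * v $ Suc j = a (Suc j) * (v $ 0 * \<phi> (Suc j))"
          using \<psi>_\<phi>[of j] less.prems Suc by simp
        thus ?thesis using a[of "Suc j"] less.prems Suc by simp
      qed
    qed
    have "v $ 0 \<noteq> 0"
    proof
      assume "v $ 0 = 0"
      hence "v = 0\<^sub>v p" using vphi v(1) by (intro eq_vecI) auto
      thus False using v(2) by simp
    qed
    moreover have "0 = v $ 0 * \<psi> (p - 1)"
    proof -
      have "v $ (p - 1) = v $ 0 * \<phi> (p - 1)" "v $ (p - 1 - 1) = v $ 0 * \<phi> (p - 1 - 1)"
        by (rule vphi; use p in simp)+
      from v\<psi>[OF _ this] show ?thesis using p by simp
    qed
    ultimately show "poly (jacobi_poly a b p) \<mu> = 0" using root by simp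
  next
    assume "poly (jacobi_poly a b p) \<mu> = 0"
    hence \<psi>0: "\<psi> (p - 1) = 0" using root by simp
    define v where "v = vec p \<phi>"
    have v: "v \<in> carrier_vec p" by (simp add: v_def)
    have "jacobi_mat a b p *\<^sub>v v = \<mu> \<cdot>\<^sub>v v"
    proof (rule eq_vecI)
      fix i assume "i < dim_vec (\<mu> \<cdot>\<^sub>v v)"
      hence i: "i < p" by (simp add: v_def)
      have "(if Suc i < p then a (Suc i) * \<phi> (Suc i) else 0) = \<psi> i"
        using \<psi>_\<phi>[of i] \<psi>0 i by (cases "Suc i < p") (auto dest: Suc_lessI)
      thus "(jacobi_mat a b p *\<^sub>v v) $ i = (\<mu> \<cdot>\<^sub>v v) $ i"
        unfolding jacobi_mat_mult_vec[OF v i] using \<psi>_eq[OF i] i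
        by (auto simp: v_def algebra_simps split: if_splits)
    qed (simp add: v_def jacobi_mat_def)
    moreover have "v \<noteq> 0\<^sub>v p"
    proof
      assume "v = 0\<^sub>v p"
      hence "v $ 0 = 0" using p by simp
      thus False using p by (simp add: v_def \<phi>_def \<pi>_def)
    qed
    ultimately show "eigenvalue (jacobi_mat a b p) \<mu>"
      using v unfolding eigenvalue_def eigenvector_def by (auto simp: jacobi_mat_def)
  qed
qed

lemma jacobi_mat_plus_eq: "p \<ge> 1 \<Longrightarrow> jacobi_mat_plus a b p = jacobi_mat a (b(p := b p + (a p)\<^sup>2)) p"
  by (rule eq_matI) (auto simp: jacobi_mat_plus_def jacobi_mat_def)

lemma jacobi_mat_minus_eq: "p \<ge> 1 \<Longrightarrow> jacobi_mat_minus a b p = jacobi_mat a (b(p := b p - (a p)\<^sup>2)) p"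
  by (rule eq_matI) (auto simp: jacobi_mat_minus_def jacobi_mat_def)

lemma jacobi_poly_last:
  assumes "p \<ge> 1"
  shows "jacobi_poly a (b(p := b p + s * (a p)\<^sup>2)) p = jacobi_poly a b p - smult s (jacobi_tail a b p)"
proof -
  obtain k where k: "p = Suc k" using assms by (cases p) auto
  let ?b = "b(p := b p + s * (a p)\<^sup>2)"
  have "jacobi_poly a ?b k = jacobi_poly a b k" "jacobi_tail a ?b k = jacobi_tail a b k"
    unfolding k by (auto intro!: jacobi_poly_cong jacobi_tail_cong)
  thus ?thesis
    unfolding k jacobi_poly_Suc jacobi_tail.simps by (simp add: k algebra_simps smult_add_left smult_diff_left)
qed

lemma sorted_list_of_strict_mono_image:
  fixes x :: "nat \<Rightarrow> real"
  assumes "strict_mono_on {1..p} x" "j \<in> {1..p}"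
  shows "sorted_list_of_set (x ` {1..p}) ! (j - 1) = x j"
proof -
  have "sorted_wrt (<) (map x [1..<Suc p])"
    unfolding sorted_wrt_map
    by (rule sorted_wrt_mono_rel[OF _ sorted_wrt_upt]) (use strict_mono_onD[OF assms(1)] in auto)
  hence "sorted (map x [1..<Suc p])" "distinct (map x [1..<Suc p])"
    using strict_sorted_iff by blast+
  hence "sorted_list_of_set (set (map x [1..<Suc p])) = map x [1..<Suc p]"
    by (simp only: sorted_list_of_set.idem_if_sorted_distinct)
  moreover have "set (map x [1..<Suc p]) = x ` {1..p}" by auto
  moreover have "map x [1..<Suc p] ! (j - 1) = x j"
    using assms(2) by (subst nth_map) (auto simp del: upt_Suc)
  ultimately show ?thesis by simp
qed

lemma poly_rootprod_eq_0_iff: "poly (rootprod p x) t = 0 \<longleftrightarrow> t \<in> x ` {1..p}"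
  by (auto simp: poly_rootprod)

text \<open>
  A polynomial with \<open>p\<close> simple roots has only one increasing list of \<open>p\<close> roots.
\<close>
lemma strict_mono_roots_unique:
  assumes "strict_mono_on {1..p} z" "strict_mono_on {1..p} w"
    "\<And>j. j \<in> {1..p} \<Longrightarrow> poly (rootprod p w) (z j) = 0" "j \<in> {1..p}"
  shows "z j = w j"
proof -
  have "z ` {1..p} \<subseteq> w ` {1..p}" using assms(3) by (auto simp: poly_rootprod_eq_0_iff)
  moreover have "card (z ` {1..p}) = card (w ` {1..p})"
    using assms(1,2) by (simp add: card_image strict_mono_on_imp_inj_on)
  ultimately have "z ` {1..p} = w ` {1..p}" by (simp add: card_subset_eq)
  thus ?thesis
    using sorted_list_of_strict_mono_image[OF assms(1,4)] sorted_list_of_strict_mono_image[OF assms(2,4)] by simp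
qed

lemma spectrum_jacobi_mat_last:
  assumes "p \<ge> 1" "\<And>i. i \<in> {1..<p} \<Longrightarrow> a i \<noteq> 0"
    and "jacobi_poly a b p - smult s (jacobi_tail a b p) = rootprod p x"
  shows "spectrum (jacobi_mat a (b(p := b p + s * (a p)\<^sup>2)) p) = x ` {1..p}"
  using eigenvalue_jacobi_mat[OF assms(1,2)] assms(3)
  by (auto simp: spectrum_def jacobi_poly_last[OF assms(1)] poly_rootprod_eq_0_iff)

section \<open>The spectral map\<close>

text \<open>
  The union of the nondegenerate and the degenerate perturbations. The spectral map is studied on
  this larger set, where the condition on the last pair of coordinates does not interfere.
\<close>
definition perturbations :: "nat \<Rightarrow> (nat \<Rightarrow> real) set" where
  "perturbations p = {q \<in> Rvec (2 * p). \<forall>x\<in>{1..p}. coeff_a q x > 0}"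

lemma spaces_in_perturbations:
  assumes "p \<ge> 1"
  shows "X_space p \<union> X_degenerate p = perturbations p"
    and "X_space p = {q \<in> perturbations p. q (2 * p - 1) \<noteq> 0 \<or> q (2 * p) \<noteq> 0}"
    and "X_degenerate p = {q \<in> perturbations p. q (2 * p - 1) = 0 \<and> q (2 * p) = 0}"
proof -
  have "bounded (range h) \<and> h 0 = 0 \<and> (\<forall>x\<ge>1. h (2 * x) > -1) \<and> (\<forall>x>2 * p. h x = 0)
      \<longleftrightarrow> h \<in> perturbations p" for h
  proof
    assume h: "h \<in> perturbations p"
    hence z: "h i = 0" if "i \<notin> {1..2 * p}" for i
      using that by (auto simp: perturbations_def Rvec_def)
    have "range h \<subseteq> h ` {0..2 * p}"
    proof
      fix t assume "t \<in> range h"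
      then obtain i where i: "t = h i" by auto
      show "t \<in> h ` {0..2 * p}" using z[of i] z[of 0] i by (cases "i \<le> 2 * p") auto
    qed
    hence "bounded (range h)" by (meson bounded_subset finite_imageI finite_atLeastAtMost finite_imp_bounded)
    moreover have "h (2 * x) > -1" if "x \<ge> 1" for x
    proof (cases "x \<le> p")
      case True
      thus ?thesis using h that by (force simp: perturbations_def coeff_a_def)
    next
      case False
      thus ?thesis using z[of "2 * x"] by simp
    qed
    ultimately show "bounded (range h) \<and> h 0 = 0 \<and> (\<forall>x\<ge>1. h (2 * x) > -1) \<and> (\<forall>x>2 * p. h x = 0)"
      using z by auto
  next
    assume h: "bounded (range h) \<and> h 0 = 0 \<and> (\<forall>x\<ge>1. h (2 * x) > -1) \<and> (\<forall>x>2 * p. h x = 0)"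
    have "h i = 0" if "i \<notin> {1..2 * p}" for i using h that by (cases "i = 0") auto
    moreover have "coeff_a h x > 0" if "x \<in> {1..p}" for x
    proof -
      from h that have "h (2 * x) > -1" by auto
      thus ?thesis by (simp add: coeff_a_def)
    qed
    ultimately show "h \<in> perturbations p" by (simp add: perturbations_def Rvec_def)
  qed
  note * = this
  show 1: "X_space p = {q \<in> perturbations p. q (2 * p - 1) \<noteq> 0 \<or> q (2 * p) \<noteq> 0}"
    unfolding X_space_def *[symmetric] by auto
  show 2: "X_degenerate p = {q \<in> perturbations p. q (2 * p - 1) = 0 \<and> q (2 * p) = 0}"
    unfolding X_degenerate_def *[symmetric] by auto
  show "X_space p \<union> X_degenerate p = perturbations p" unfolding 1 2 by auto
qed

abbreviation P_poly :: "(nat \<Rightarrow> real) \<Rightarrow> nat \<Rightarrow> real poly" where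
  "P_poly q \<equiv> jacobi_poly (coeff_a q) (coeff_b q)"

abbreviation T_poly :: "(nat \<Rightarrow> real) \<Rightarrow> nat \<Rightarrow> real poly" where
  "T_poly q \<equiv> jacobi_tail (coeff_a q) (coeff_b q)"

lemma alpha_eqI:
  assumes p: "p \<ge> 1" and q: "q \<in> perturbations p" and j: "j \<in> {1..p}"
  shows "P_poly q p + T_poly q p = rootprod p lo \<Longrightarrow> strict_mono_on {1..p} lo \<Longrightarrow> alpha_minus p q j = lo j"
    and "P_poly q p - T_poly q p = rootprod p hi \<Longrightarrow> strict_mono_on {1..p} hi \<Longrightarrow> alpha_plus p q j = hi j"
proof -
  have a: "coeff_a q i \<noteq> 0" if "i \<in> {1..<p}" for i
    using q that by (force simp: perturbations_def)
  show "alpha_minus p q j = lo j" if "P_poly q p + T_poly q p = rootprod p lo" "strict_mono_on {1..p} lo"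
    using spectrum_jacobi_mat_last[where a = "coeff_a q" and b = "coeff_b q" and s = "-1" and x = lo, OF p a] that j
    by (simp add: alpha_minus_def eigenvalue_nth_def jacobi_mat_minus_eq[OF p] sorted_list_of_strict_mono_image
        del: One_nat_def)
  show "alpha_plus p q j = hi j" if "P_poly q p - T_poly q p = rootprod p hi" "strict_mono_on {1..p} hi"
    using spectrum_jacobi_mat_last[where a = "coeff_a q" and b = "coeff_b q" and s = 1 and x = hi, OF p a] that j
    by (simp add: alpha_plus_def eigenvalue_nth_def jacobi_mat_plus_eq[OF p] sorted_list_of_strict_mono_image
        del: One_nat_def)
qed

text \<open>
  The interlacing of the eigenvalues of \<open>J\<^sup>-\<close> and \<open>J\<^sup>+\<close>, together with the two relations by which
  they encode the pair of polynomials.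
\<close>
lemma alpha_rootprod:
  assumes p: "p \<ge> 1" and q: "q \<in> perturbations p"
  shows "interlaced p (alpha_minus p q) (alpha_plus p q)"
    and "P_poly q p + T_poly q p = rootprod p (alpha_minus p q)"
    and "P_poly q p - T_poly q p = rootprod p (alpha_plus p q)"
proof -
  obtain x where x: "P_poly q p = rootprod p x" "interlacing p x (T_poly q p)"
    using jacobi_poly_interlacing[of p "coeff_a q" "coeff_b q"] q by (auto simp: perturbations_def)
  obtain lo hi where lh: "interlaced p lo hi" "P_poly q p + T_poly q p = rootprod p lo"
    "P_poly q p - T_poly q p = rootprod p hi"
    using interlacing_imp_interlaced[OF x(2)] unfolding x(1) by blast
  have lo: "alpha_minus p q j = lo j" and hi: "alpha_plus p q j = hi j" if "j \<in> {1..p}" for j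
    using alpha_eqI(1)[OF p q that lh(2) interlaced_mono(1)[OF lh(1)]]
      alpha_eqI(2)[OF p q that lh(3) interlaced_mono(2)[OF lh(1)]] by simp_all
  show "interlaced p (alpha_minus p q) (alpha_plus p q)"
    using lh(1) by (auto simp: interlaced_def lo hi)
  show "P_poly q p + T_poly q p = rootprod p (alpha_minus p q)"
    unfolding lh(2) rootprod_def by (rule prod.cong) (simp_all add: lo)
  show "P_poly q p - T_poly q p = rootprod p (alpha_plus p q)"
    unfolding lh(3) rootprod_def by (rule prod.cong) (simp_all add: hi)
qed

lemma E_space_iff:
  "\<alpha> \<in> E_space (2 * p) \<longleftrightarrow> \<alpha> \<in> Rvec (2 * p) \<and> interlaced p (\<lambda>j. \<alpha> (2 * j - 1)) (\<lambda>j. \<alpha> (2 * j))"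
proof -
  have "strict_mono_on {1..2 * p} \<alpha>" if "interlaced p (\<lambda>j. \<alpha> (2 * j - 1)) (\<lambda>j. \<alpha> (2 * j))"
  proof (rule strict_mono_on_atLeastAtMostI)
    fix i assume i: "1 \<le> i" "i < 2 * p"
    show "\<alpha> i < \<alpha> (Suc i)"
    proof (cases "even i")
      case True
      then obtain j where "i = 2 * j" by (auto elim: evenE)
      thus ?thesis using that i by (auto simp: interlaced_def)
    next
      case False
      then obtain j where "i = 2 * j + 1" by (auto elim: oddE)
      thus ?thesis using that i by (auto simp: interlaced_def dest!: bspec[of _ _ "Suc j"])
    qed
  qed
  moreover have "interlaced p (\<lambda>j. \<alpha> (2 * j - 1)) (\<lambda>j. \<alpha> (2 * j))" if "strict_mono_on {1..2 * p} \<alpha>"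
    using that unfolding interlaced_def by (auto intro!: strict_mono_onD[OF that])
  ultimately show ?thesis by (auto simp: E_space_def)
qed

lemma alpha_star_simps:
  assumes "j \<in> {1..p}"
  shows "alpha_star p q (2 * j - 1) = alpha_minus p q j" "alpha_star p q (2 * j) = alpha_plus p q j"
proof -
  obtain k where k: "j = Suc k" using assms by (cases j) auto
  show "alpha_star p q (2 * j - 1) = alpha_minus p q j" using assms by (simp add: k alpha_star_def)
  show "alpha_star p q (2 * j) = alpha_plus p q j" using assms by (simp add: k alpha_star_def)
qed

lemma alpha_star_Rvec: "alpha_star p q \<in> Rvec (2 * p)"
  by (simp add: Rvec_def alpha_star_def)

lemma alpha_star_in_E_space:
  assumes "p \<ge> 1" "q \<in> perturbations p"
  shows "alpha_star p q \<in> E_space (2 * p)"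
  unfolding E_space_iff
proof (intro conjI alpha_star_Rvec)
  have "(\<forall>i\<in>{1..p}. alpha_minus p q i < alpha_plus p q i) \<and>
      (\<forall>i\<in>{1..<p}. alpha_plus p q i < alpha_minus p q (Suc i))"
    using alpha_rootprod(1)[OF assms] by (simp only: interlaced_def)
  thus "interlaced p (\<lambda>j. alpha_star p q (2 * j - 1)) (\<lambda>j. alpha_star p q (2 * j))"
    unfolding interlaced_def
    by (intro conjI ballI; subst alpha_star_simps(1), force, subst alpha_star_simps(2)) auto
qed

text \<open>
  Half the sum and half the difference of the two products over the given sequence form an
  interlacing pair, which Euclid's algorithm resolves into positive \<open>a\<close> and real \<open>b\<close>.
\<close>
lemma alpha_star_surj:
  assumes p: "p \<ge> 1" and \<alpha>: "\<alpha> \<in> E_space (2 * p)"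
  obtains q where "q \<in> perturbations p" "alpha_star p q = \<alpha>"
proof -
  let ?lo = "\<lambda>j. \<alpha> (2 * j - 1)" and ?hi = "\<lambda>j. \<alpha> (2 * j)"
  have il: "interlaced p ?lo ?hi" using \<alpha> by (simp add: E_space_iff)
  obtain x where x: "rootprod p x = smult (1/2) (rootprod p ?lo + rootprod p ?hi)"
    "interlacing p x (smult (1/2) (rootprod p ?lo - rootprod p ?hi))"
    using interlaced_imp_interlacing[OF il] by blast
  obtain a b where ab: "\<And>i. i \<in> {1..p} \<Longrightarrow> a i > 0" "jacobi_poly a b p = rootprod p x"
    "jacobi_tail a b p = smult (1/2) (rootprod p ?lo - rootprod p ?hi)"
    using interlacing_imp_jacobi_poly[OF x(2)] by metis
  define q where "q i = (if i \<in> {1..2 * p} then perturbation a b i else 0)" for i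
  have qa: "coeff_a q i = a i" and qb: "coeff_b q i = b i" if i: "i \<in> {1..p}" for i
  proof -
    obtain k where k: "i = Suc k" using i by (cases i) auto
    show "coeff_a q i = a i" "coeff_b q i = b i"
      using i by (auto simp: k q_def coeff_a_def coeff_b_def perturbation_def)
  qed
  have "P_poly q p = jacobi_poly a b p" "T_poly q p = jacobi_tail a b p"
    using qa qb by (auto intro!: jacobi_poly_cong jacobi_tail_cong)
  moreover have half: "smult (1/2) (A + B) + smult (1/2) (A - B) = A"
    "smult (1/2) (A + B) - smult (1/2) (A - B) = B" for A B :: "real poly"
    by (rule poly_eqI; simp add: field_simps)+
  ultimately have PT: "P_poly q p + T_poly q p = rootprod p ?lo" "P_poly q p - T_poly q p = rootprod p ?hi"
    unfolding ab x(1) by (simp_all only: half)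
  have q: "q \<in> perturbations p"
    using ab(1) qa by (auto simp: perturbations_def Rvec_def q_def)
  have "alpha_star p q i = \<alpha> i" for i
  proof (cases "i \<in> {1..2 * p}")
    case True
    show ?thesis
    proof (cases "even i")
      case True
      then obtain j where j: "i = 2 * j" by (auto elim: evenE)
      thus ?thesis
        using alpha_eqI(2)[OF p q _ PT(2) interlaced_mono(2)[OF il], of j] alpha_star_simps(2)[of j p q] \<open>i \<in> {1..2 * p}\<close>
        by simp
    next
      case False
      then obtain k where k: "i = 2 * Suc k - 1" by (auto elim: oddE)
      thus ?thesis
        using alpha_eqI(1)[OF p q _ PT(1) interlaced_mono(1)[OF il], of "Suc k"]
          alpha_star_simps(1)[of "Suc k" p q] \<open>i \<in> {1..2 * p}\<close>
        by simp
    qed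
  next
    case False
    thus ?thesis using \<alpha> alpha_star_Rvec[of p q] by (simp add: E_space_def Rvec_def)
  qed
  thus ?thesis using that[OF q] by auto
qed

section \<open>Recovering the perturbation\<close>

text \<open>
  Polynomials are represented by their coefficient terms, one for each degree, including the
  infinitely many that evaluate to \<open>0\<close>.
\<close>
definition computes :: "(nat \<Rightarrow> real) \<Rightarrow> (nat \<Rightarrow> real_alg) \<Rightarrow> real poly \<Rightarrow> bool" where
  "computes v A P \<longleftrightarrow> (\<forall>i. run_alg v (A i) = Some (coeff P i))"

definition shift_alg :: "(nat \<Rightarrow> real_alg) \<Rightarrow> nat \<Rightarrow> real_alg" where
  "shift_alg A i = (case i of 0 \<Rightarrow> Const 0 | Suc j \<Rightarrow> A j)"

primrec rootprod_alg :: "(nat \<Rightarrow> nat) \<Rightarrow> nat \<Rightarrow> nat \<Rightarrow> real_alg" where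
  "rootprod_alg r 0 = (\<lambda>i. Const (if i = 0 then 1 else 0))"
| "rootprod_alg r (Suc k) =
     (\<lambda>i. Sub (shift_alg (rootprod_alg r k) i) (Mul (Input (r (Suc k))) (rootprod_alg r k i)))"

text \<open>
  The next three definitions form the Euclidean step at level \<open>l + 1\<close>. The term \<open>B l\<close> stands for
  \<open>a\<^sup>2\<close> at this level.
\<close>
definition normalize_alg :: "nat \<Rightarrow> (nat \<Rightarrow> real_alg) \<Rightarrow> nat \<Rightarrow> real_alg" where
  "normalize_alg l B i = Div (B i) (B l)"

definition diag_alg :: "nat \<Rightarrow> (nat \<Rightarrow> real_alg) \<Rightarrow> (nat \<Rightarrow> real_alg) \<Rightarrow> real_alg" where
  "diag_alg l A B = Sub (shift_alg (normalize_alg l B) l) (A l)"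

definition remainder_alg ::
    "nat \<Rightarrow> (nat \<Rightarrow> real_alg) \<Rightarrow> (nat \<Rightarrow> real_alg) \<Rightarrow> nat \<Rightarrow> real_alg" where
  "remainder_alg l A B i =
     Sub (Sub (shift_alg (normalize_alg l B) i) (Mul (diag_alg l A B) (normalize_alg l B i))) (A i)"

text \<open>
  The pair of polynomials at level \<open>p - n\<close>. The inputs at odd positions are the roots of \<open>A + B\<close>,
  those at even positions the roots of \<open>A - B\<close>.
\<close>
fun levels_alg :: "nat \<Rightarrow> nat \<Rightarrow> (nat \<Rightarrow> real_alg) \<times> (nat \<Rightarrow> real_alg)" where
  "levels_alg p 0 =
     (let lo = rootprod_alg (\<lambda>j. 2 * j - 1) p; hi = rootprod_alg (\<lambda>j. 2 * j) p
      in (\<lambda>i. Div (Add (lo i) (hi i)) (Const 2), \<lambda>i. Div (Sub (lo i) (hi i)) (Const 2)))"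
| "levels_alg p (Suc n) =
     (let (A, B) = levels_alg p n; l = p - Suc n in (normalize_alg l B, remainder_alg l A B))"

definition inverse_alg :: "nat \<Rightarrow> nat \<Rightarrow> real_alg" where
  "inverse_alg p i =
     (let x = (i + 1) div 2; (A, B) = levels_alg p (p - x)
      in if even i then Sub (Sqrt (B (x - 1))) (Const 1) else diag_alg (x - 1) A B)"

lemma computes_shift: "computes v A P \<Longrightarrow> computes v (shift_alg A) (pCons 0 P)"
  by (auto simp: computes_def shift_alg_def coeff_pCons split: nat.split)

lemma computes_rootprod: "computes v (rootprod_alg r k) (rootprod k (\<lambda>j. v (r j)))"
proof (induction k)
  case (Suc k)
  thus ?case using computes_shift[OF Suc] by (simp add: computes_def rootprod_Suc)
qed (simp add: computes_def)

lemma coeff_jacobi_poly_top: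
  assumes "\<And>i. i \<in> {1..k} \<Longrightarrow> a i > 0"
  shows "coeff (jacobi_poly a b k) k = 1" "coeff (jacobi_tail a b k) k = 0"
proof -
  obtain x where "jacobi_poly a b k = rootprod k x" "interlacing k x (jacobi_tail a b k)"
    using jacobi_poly_interlacing[of k a b] assms by blast
  thus "coeff (jacobi_poly a b k) k = 1" "coeff (jacobi_tail a b k) k = 0"
    by (simp_all add: interlacing_def)
qed

lemma computes_step:
  assumes A: "computes v A (jacobi_poly a b (Suc l))" and B: "computes v B (jacobi_tail a b (Suc l))"
    and a: "\<And>i. i \<in> {1..Suc l} \<Longrightarrow> a i > 0"
  shows "run_alg v (B l) = Some ((a (Suc l))\<^sup>2)"
    and "run_alg v (diag_alg l A B) = Some (b (Suc l))"
    and "computes v (normalize_alg l B) (jacobi_poly a b l)"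
    and "computes v (remainder_alg l A B) (jacobi_tail a b l)"
proof -
  have top: "coeff (jacobi_poly a b l) l = 1" "coeff (jacobi_tail a b l) l = 0"
    using coeff_jacobi_poly_top[of l a b] a by simp_all
  have a0: "a (Suc l) \<noteq> 0" using a[of "Suc l"] by simp
  show Bl: "run_alg v (B l) = Some ((a (Suc l))\<^sup>2)" using B top by (simp add: computes_def)
  show N: "computes v (normalize_alg l B) (jacobi_poly a b l)"
    using B a0 Bl by (simp add: computes_def normalize_alg_def)
  show d: "run_alg v (diag_alg l A B) = Some (b (Suc l))"
    using computes_shift[OF N] A top by (simp add: computes_def diag_alg_def jacobi_poly_Suc)
  show "computes v (remainder_alg l A B) (jacobi_tail a b l)"
    using computes_shift[OF N] N A d by (simp add: computes_def remainder_alg_def jacobi_poly_Suc)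
qed

lemma computes_levels:
  assumes p: "p \<ge> 1" and q: "q \<in> perturbations p" and n: "n \<le> p"
  shows "computes (alpha_star p q) (fst (levels_alg p n)) (P_poly q (p - n)) \<and>
    computes (alpha_star p q) (snd (levels_alg p n)) (T_poly q (p - n))"
  using n
proof (induction n)
  case 0
  have "rootprod p (\<lambda>j. alpha_star p q (2 * j - 1)) = P_poly q p + T_poly q p"
    unfolding alpha_rootprod(2)[OF p q] rootprod_def by (rule prod.cong) (simp_all only: alpha_star_simps)
  moreover have "rootprod p (\<lambda>j. alpha_star p q (2 * j)) = P_poly q p - T_poly q p"
    unfolding alpha_rootprod(3)[OF p q] rootprod_def by (rule prod.cong) (simp_all only: alpha_star_simps)
  ultimately show ?case
    using computes_rootprod[of "alpha_star p q" "\<lambda>j. 2 * j - 1" p]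
      computes_rootprod[of "alpha_star p q" "\<lambda>j. 2 * j" p]
    by (simp add: computes_def Let_def)
next
  case (Suc n)
  define l where "l = p - Suc n"
  have l: "p - n = Suc l" using Suc.prems by (simp add: l_def)
  have "coeff_a q i > 0" if "i \<in> {1..Suc l}" for i
    using q that Suc.prems by (auto simp: perturbations_def l_def)
  thus ?case
    using computes_step(3,4)[of "alpha_star p q" "fst (levels_alg p n)" "coeff_a q" "coeff_b q" l
        "snd (levels_alg p n)"] Suc
    unfolding l by (simp add: l_def[symmetric] Let_def split_beta)
qed

lemma run_levels:
  assumes p: "p \<ge> 1" and q: "q \<in> perturbations p" and x: "x \<in> {1..p}"
  shows "run_alg (alpha_star p q) (snd (levels_alg p (p - x)) (x - 1)) = Some ((coeff_a q x)\<^sup>2)"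
    and "run_alg (alpha_star p q) (diag_alg (x - 1) (fst (levels_alg p (p - x))) (snd (levels_alg p (p - x)))) =
      Some (coeff_b q x)"
proof -
  obtain l where l: "x = Suc l" using x by (cases x) auto
  have px: "p - (p - x) = Suc l" using x l by simp
  have a: "coeff_a q i > 0" if "i \<in> {1..Suc l}" for i
    using q that x l by (auto simp: perturbations_def)
  note c = computes_levels[OF p q, of "p - x", unfolded px]
  show "run_alg (alpha_star p q) (snd (levels_alg p (p - x)) (x - 1)) = Some ((coeff_a q x)\<^sup>2)"
    "run_alg (alpha_star p q) (diag_alg (x - 1) (fst (levels_alg p (p - x))) (snd (levels_alg p (p - x)))) =
      Some (coeff_b q x)"
    using computes_step(1,2)[OF conjunct1[OF c] conjunct2[OF c] a] l by simp_all
qed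

lemma run_inverse_alg:
  assumes p: "p \<ge> 1" and q: "q \<in> perturbations p" and i: "i \<in> {1..2 * p}"
  shows "run_alg (alpha_star p q) (inverse_alg p i) = Some (q i)"
proof -
  define x where "x = (i + 1) div 2"
  have x: "x \<in> {1..p}" using i by (auto simp: x_def)
  note r = run_levels[OF p q x]
  have a: "coeff_a q x > 0" using q x by (simp add: perturbations_def)
  show ?thesis
  proof (cases "even i")
    case True
    hence "i = 2 * x" by (auto simp: x_def)
    thus ?thesis using r(1) a
      by (simp add: inverse_alg_def split_beta Let_def x_def[symmetric] coeff_a_def)
  next
    case False
    hence "i = 2 * x - 1" by (auto simp: x_def elim: oddE)
    thus ?thesis using r(2) False
      by (simp add: inverse_alg_def split_beta Let_def x_def[symmetric] coeff_b_def)
  qed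
qed

lemma sqrt_free_levels:
  "sqrt_free (fst (levels_alg p n) i)" "sqrt_free (snd (levels_alg p n) i)"
proof -
  have shift: "sqrt_free (shift_alg A i)" if "\<And>i. sqrt_free (A i)" for A i
    using that by (simp add: shift_alg_def split: nat.split)
  have root: "sqrt_free (rootprod_alg r k i)" for r k i
    by (induction k arbitrary: i) (simp_all add: shift)
  have "(\<forall>i. sqrt_free (fst (levels_alg p n) i)) \<and> (\<forall>i. sqrt_free (snd (levels_alg p n) i))"
    by (induction n)
       (auto simp: Let_def root shift split_beta normalize_alg_def remainder_alg_def diag_alg_def
         intro!: shift)
  thus "sqrt_free (fst (levels_alg p n) i)" "sqrt_free (snd (levels_alg p n) i)" by auto
qed

lemma sqrt_free_diag_alg:
  "sqrt_free (diag_alg l (fst (levels_alg p n)) (snd (levels_alg p n)))"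
  by (auto simp: diag_alg_def shift_alg_def normalize_alg_def sqrt_free_levels split: nat.split)

text \<open>
  The only square root is the outermost operation, and its radicand evaluates to \<open>a\<^sub>x\<^sup>2 > 0\<close>.
\<close>
lemma inverse_alg_analytic:
  assumes p: "p \<ge> 1" and q: "q \<in> perturbations p" and i: "i \<in> {1..2 * p}"
  shows "real_analytic_at (2 * p) (alpha_star p q) (\<lambda>\<alpha>. the (run_alg \<alpha> (inverse_alg p i)))"
proof -
  define x where "x = (i + 1) div 2"
  have x: "x \<in> {1..p}" using i by (auto simp: x_def)
  note r = run_levels[OF p q x]
  have a: "coeff_a q x > 0" using q x by (simp add: perturbations_def)
  show ?thesis
  proof (cases "even i")
    case True
    hence ix: "i = 2 * x" by (auto simp: x_def)
    obtain g where g: "real_analytic_at (2 * p) (alpha_star p q) g" "g (alpha_star p q) = (coeff_a q x)\<^sup>2"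
      "eventually (\<lambda>\<alpha>. run_alg \<alpha> (snd (levels_alg p (p - x)) (x - 1)) = Some (g \<alpha>)) (near (2 * p) (alpha_star p q))"
      using run_alg_analytic[OF alpha_star_Rvec sqrt_free_levels(2) r(1)] by blast
    have pos: "g (alpha_star p q) > 0" using g(2) a by simp
    have "eventually (\<lambda>\<alpha>. sqrt (g \<alpha>) - 1 = the (run_alg \<alpha> (inverse_alg p i))) (near (2 * p) (alpha_star p q))"
      using g(3) real_analytic_at_near_pos[OF g(1) alpha_star_Rvec pos]
      by eventually_elim (simp add: ix inverse_alg_def Let_def split_beta)
    thus ?thesis
      by (rule real_analytic_at_cong[rotated])
         (intro real_analytic_at_diff real_analytic_at_sqrt g(1) alpha_star_Rvec pos real_analytic_at_const)
  next
    case False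
    then obtain l where l: "i = 2 * l + 1" by (auto elim: oddE)
    hence xl: "x = Suc l" by (simp add: x_def)
    obtain g where g: "real_analytic_at (2 * p) (alpha_star p q) g"
      "eventually (\<lambda>\<alpha>. run_alg \<alpha> (diag_alg (x - 1) (fst (levels_alg p (p - x))) (snd (levels_alg p (p - x)))) =
         Some (g \<alpha>)) (near (2 * p) (alpha_star p q))"
      using run_alg_analytic[OF alpha_star_Rvec sqrt_free_diag_alg r(2)] by blast
    have "eventually (\<lambda>\<alpha>. g \<alpha> = the (run_alg \<alpha> (inverse_alg p i))) (near (2 * p) (alpha_star p q))"
      using g(2)
      by eventually_elim (simp add: l xl inverse_alg_def Let_def split_beta)
    thus ?thesis by (rule real_analytic_at_cong[OF g(1)])
  qed
qed

section \<open>Analyticity of the spectral map\<close>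

lemma near_perturbations:
  assumes "q \<in> perturbations p"
  shows "eventually (\<lambda>y. y \<in> perturbations p) (near (2 * p) q)"
proof -
  have q: "q \<in> Rvec (2 * p)" using assms by (simp add: perturbations_def)
  have "eventually (\<lambda>y. coeff_a y x > 0) (near (2 * p) q)" if "x \<in> {1..p}" for x
    unfolding coeff_a_def
    by (rule real_analytic_at_near_pos[OF _ q])
       (use assms that in \<open>auto simp: perturbations_def coeff_a_def
          intro!: real_analytic_at_add real_analytic_at_coordinate real_analytic_at_const\<close>)
  hence "eventually (\<lambda>y. \<forall>x\<in>{1..p}. coeff_a y x > 0) (near (2 * p) q)"
    by (simp add: eventually_ball_finite)
  with eventually_near_Rvec[of "2 * p" q] show ?thesis
    by eventually_elim (simp add: perturbations_def)
qed

lemma near_strict_mono: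
  fixes f :: "nat \<Rightarrow> (nat \<Rightarrow> real) \<Rightarrow> real"
  assumes x: "x \<in> Rvec m" and f: "\<And>i. i \<in> {1..n} \<Longrightarrow> real_analytic_at m x (f i)"
    and mono: "strict_mono_on {1..n} (\<lambda>i. f i x)"
  shows "eventually (\<lambda>y. strict_mono_on {1..n} (\<lambda>i. f i y)) (near m x)"
proof -
  have "eventually (\<lambda>y. f (Suc i) y - f i y > 0) (near m x)" if "i \<in> {1..<n}" for i
    by (rule real_analytic_at_near_pos[OF real_analytic_at_diff x])
       (use that f strict_mono_onD[OF mono, of i "Suc i"] in auto)
  hence "eventually (\<lambda>y. \<forall>i\<in>{1..<n}. f (Suc i) y - f i y > 0) (near m x)"
    by (simp add: eventually_ball_finite)
  thus ?thesis
    by eventually_elim (rule strict_mono_on_atLeastAtMostI, auto)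
qed

lemma near_E_space:
  assumes "\<alpha> \<in> E_space m"
  shows "eventually (\<lambda>y. y \<in> E_space m) (near m \<alpha>)"
proof -
  have "eventually (\<lambda>y. strict_mono_on {1..m} (\<lambda>i. y i)) (near m \<alpha>)"
    by (rule near_strict_mono) (use assms in \<open>auto simp: E_space_def real_analytic_at_coordinate\<close>)
  with eventually_near_Rvec[of m \<alpha>] show ?thesis
    by eventually_elim (simp add: E_space_def)
qed

lemma pderiv_rootprod_neq_0:
  assumes z: "inj_on z {1..p}" and j: "j \<in> {1..p}"
  shows "poly (pderiv (rootprod p z)) (z j) \<noteq> 0"
proof -
  define H where "H = (\<Prod>i\<in>{1..p} - {j}. [:- z i, 1:])"
  have "rootprod p z = [:- z j, 1:] * H"
    unfolding rootprod_def H_def using j by (subst prod.remove[of _ j]) auto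
  hence "poly (pderiv (rootprod p z)) (z j) = poly H (z j)"
    by (simp only: pderiv_mult poly_add poly_mult) (simp add: pderiv_pCons)
  also have "\<dots> = (\<Prod>i\<in>{1..p} - {j}. z j - z i)" by (simp add: H_def poly_prod)
  also have "\<dots> \<noteq> 0" by (simp add: inj_on_eq_iff[OF z j])
  finally show ?thesis .
qed

text \<open>
  Each root continues to an analytic branch. By continuity the branches stay in increasing order
  near \<open>x\<close>, so the \<open>j\<close>-th branch is the \<open>j\<close>-th smallest root there as well.
\<close>
lemma ordered_roots_analytic:
  fixes F :: "(nat \<Rightarrow> real) \<Rightarrow> real poly"
  assumes x: "x \<in> Rvec m" and F: "\<And>k. real_analytic_at m x (\<lambda>y. coeff (F y) k)"
    and deg: "\<And>y. degree (F y) \<le> n"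
    and roots: "F x = rootprod p (w x)" "strict_mono_on {1..p} (w x)"
    and near: "eventually (\<lambda>y. F y = rootprod p (w y) \<and> strict_mono_on {1..p} (w y)) (near m x)"
    and j: "j \<in> {1..p}"
  shows "real_analytic_at m x (\<lambda>y. w y j)"
proof -
  have "\<exists>t. real_analytic_at m x t \<and> t x = w x i \<and> eventually (\<lambda>y. poly (F y) (t y) = 0) (near m x)"
    if "i \<in> {1..p}" for i
  proof -
    have "poly (F x) (w x i) = 0" using that by (auto simp: roots(1) poly_rootprod_eq_0_iff)
    moreover have "poly (pderiv (F x)) (w x i) \<noteq> 0"
      using pderiv_rootprod_neq_0[OF strict_mono_on_imp_inj_on[OF roots(2)] that] by (simp add: roots(1))
    ultimately show ?thesis using real_analytic_at_simple_root[OF x F deg] by metis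
  qed
  then obtain t where t: "\<And>i. i \<in> {1..p} \<Longrightarrow> real_analytic_at m x (t i)"
    "\<And>i. i \<in> {1..p} \<Longrightarrow> t i x = w x i"
    "\<And>i. i \<in> {1..p} \<Longrightarrow> eventually (\<lambda>y. poly (F y) (t i y) = 0) (near m x)"
    by metis
  have "strict_mono_on {1..p} (\<lambda>i. t i x)"
    using roots(2) t(2) by (simp add: strict_mono_on_def)
  from near_strict_mono[OF x t(1) this]
  have mono: "eventually (\<lambda>y. strict_mono_on {1..p} (\<lambda>i. t i y)) (near m x)" .
  have "eventually (\<lambda>y. \<forall>i\<in>{1..p}. poly (F y) (t i y) = 0) (near m x)"
    using t(3) by (simp add: eventually_ball_finite)
  with mono near have "eventually (\<lambda>y. t j y = w y j) (near m x)"
  proof eventually_elim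
    case (elim y)
    show ?case
      by (rule strict_mono_roots_unique[where z = "\<lambda>i. t i y" and p = p]) (use elim j in auto)
  qed
  thus ?thesis by (rule real_analytic_at_cong[OF t(1)[OF j]])
qed

lemma coeff_a_analytic: "real_analytic_at m x (\<lambda>y. coeff_a y l)"
  and coeff_b_analytic: "real_analytic_at m x (\<lambda>y. coeff_b y l)"
  unfolding coeff_a_def coeff_b_def
  by (intro real_analytic_at_add real_analytic_at_coordinate real_analytic_at_const)+

lemma P_poly_analytic: "real_analytic_at m x (\<lambda>y. coeff (P_poly y k) i)"
  and T_poly_analytic: "real_analytic_at m x (\<lambda>y. coeff (T_poly y k) i)"
proof -
  note a = coeff_a_analytic and b = coeff_b_analytic
  have "(\<forall>i. real_analytic_at m x (\<lambda>y. coeff (P_poly y k) i)) \<and>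
    (\<forall>i. real_analytic_at m x (\<lambda>y. coeff (T_poly y k) i))"
  proof (induction k)
    case 0
    show ?case by (simp add: real_analytic_at_const)
  next
    case (Suc k)
    have "real_analytic_at m x (\<lambda>y. coeff (pCons 0 (P_poly y k)) i)" for i
      by (rule real_analytic_at_coeff_pCons) (use Suc real_analytic_at_const in auto)
    hence "real_analytic_at m x (\<lambda>y. coeff (P_poly y (Suc k)) i)" for i
      unfolding jacobi_poly_Suc using Suc
      by (simp, intro real_analytic_at_diff real_analytic_at_mult b) auto
    moreover have "real_analytic_at m x (\<lambda>y. coeff (T_poly y (Suc k)) i)" for i
      using Suc by (simp, intro real_analytic_at_mult real_analytic_at_power a) auto
    ultimately show ?case by blast
  qed
  thus "real_analytic_at m x (\<lambda>y. coeff (P_poly y k) i)"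
    "real_analytic_at m x (\<lambda>y. coeff (T_poly y k) i)" by blast+
qed

lemma degree_jacobi_le: "degree (jacobi_poly a b k) \<le> k \<and> degree (jacobi_tail a b k) \<le> k"
proof (induction k)
  case (Suc k)
  have "degree (jacobi_poly a b (Suc k)) \<le> Suc k"
    unfolding jacobi_poly_Suc
  proof (rule degree_diff_le)
    show "degree ([:- b (Suc k), 1:] * jacobi_poly a b k) \<le> Suc k"
      using degree_mult_le[of "[:- b (Suc k), 1:]" "jacobi_poly a b k"] Suc by simp
  qed (use Suc in simp)
  moreover have "degree (jacobi_tail a b (Suc k)) \<le> Suc k"
    using degree_smult_le[of "(a (Suc k))\<^sup>2" "jacobi_poly a b k"] Suc by simp
  ultimately show ?case by blast
qed simp

lemma alpha_star_analytic:
  assumes p: "p \<ge> 1" and q: "q \<in> perturbations p" and i: "i \<in> {1..2 * p}"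
  shows "real_analytic_at (2 * p) q (\<lambda>y. alpha_star p y i)"
proof -
  have qR: "q \<in> Rvec (2 * p)" using q by (simp add: perturbations_def)
  have deg: "degree (P_poly y p + T_poly y p) \<le> p" "degree (P_poly y p - T_poly y p) \<le> p" for y
    using degree_jacobi_le[of "coeff_a y" "coeff_b y" p] by (auto intro: degree_add_le degree_diff_le)
  have minus: "real_analytic_at (2 * p) q (\<lambda>y. alpha_minus p y j)" if "j \<in> {1..p}" for j
  proof (rule ordered_roots_analytic[where F = "\<lambda>y. P_poly y p + T_poly y p" and w = "alpha_minus p", OF qR _ deg(1)])
    show "eventually (\<lambda>y. P_poly y p + T_poly y p = rootprod p (alpha_minus p y) \<and>
        strict_mono_on {1..p} (alpha_minus p y)) (near (2 * p) q)"
      using near_perturbations[OF q]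
      by eventually_elim (use alpha_rootprod[OF p] interlaced_mono(1) in blast)
    show "real_analytic_at (2 * p) q (\<lambda>y. coeff (P_poly y p + T_poly y p) k)" for k
      by (simp, intro real_analytic_at_add P_poly_analytic T_poly_analytic)
  qed (use alpha_rootprod[OF p q] interlaced_mono(1) that in blast)+
  have plus: "real_analytic_at (2 * p) q (\<lambda>y. alpha_plus p y j)" if "j \<in> {1..p}" for j
  proof (rule ordered_roots_analytic[where F = "\<lambda>y. P_poly y p - T_poly y p" and w = "alpha_plus p", OF qR _ deg(2)])
    show "eventually (\<lambda>y. P_poly y p - T_poly y p = rootprod p (alpha_plus p y) \<and>
        strict_mono_on {1..p} (alpha_plus p y)) (near (2 * p) q)"
      using near_perturbations[OF q]
      by eventually_elim (use alpha_rootprod[OF p] interlaced_mono(2) in blast)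
    show "real_analytic_at (2 * p) q (\<lambda>y. coeff (P_poly y p - T_poly y p) k)" for k
      by (simp, intro real_analytic_at_diff P_poly_analytic T_poly_analytic)
  qed (use alpha_rootprod[OF p q] interlaced_mono(2) that in blast)+
  show ?thesis
    using i minus[of "(i + 1) div 2"] plus[of "i div 2"] by (cases "odd i") (auto simp: alpha_star_def elim!: oddE evenE)
qed

lemma alpha_star_inj:
  assumes "p \<ge> 1" shows "inj_on (alpha_star p) (perturbations p)"
proof (rule inj_onI, rule ext)
  fix q q' i assume q: "q \<in> perturbations p" "q' \<in> perturbations p" "alpha_star p q = alpha_star p q'"
  show "q i = q' i"
  proof (cases "i \<in> {1..2 * p}")
    case True
    thus ?thesis using run_inverse_alg[OF assms q(1) True] run_inverse_alg[OF assms q(2) True] q(3) by simp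
  next
    case False
    thus ?thesis using q by (simp add: perturbations_def Rvec_def)
  qed
qed

text \<open>
  Near every point of the image, the inverse map agrees with the algorithm, which is analytic. The
  set \<open>S\<close> is a parameter because the claim is needed both with and without the degenerate
  perturbations.
\<close>
lemma alpha_star_iso:
  assumes p: "p \<ge> 1" and S: "S \<subseteq> perturbations p"
    and nearS: "\<And>q. q \<in> S \<Longrightarrow> eventually (\<lambda>y. y \<in> S) (near (2 * p) q)"
    and nearV: "\<And>q. q \<in> S \<Longrightarrow> eventually (\<lambda>y. y \<in> alpha_star p ` S) (near (2 * p) (alpha_star p q))"
  shows "real_analytic_iso (2 * p) S (alpha_star p ` S) (alpha_star p)"
  unfolding real_analytic_iso_def
proof (intro conjI)
  have inj: "inj_on (alpha_star p) S" using alpha_star_inj[OF p] S by (rule inj_on_subset)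
  thus "bij_betw (alpha_star p) S (alpha_star p ` S)" by (simp add: bij_betw_def)
  show "real_analytic_map (2 * p) (2 * p) (alpha_star p) S"
    by (rule real_analytic_mapI)
       (use S nearS alpha_star_analytic[OF p] alpha_star_Rvec in \<open>auto simp: perturbations_def\<close>)
  show "real_analytic_map (2 * p) (2 * p) (inv_into S (alpha_star p)) (alpha_star p ` S)"
  proof (rule real_analytic_mapI)
    show "alpha_star p ` S \<subseteq> Rvec (2 * p)" using alpha_star_Rvec by blast
    show "inv_into S (alpha_star p) ` alpha_star p ` S \<subseteq> Rvec (2 * p)"
      using S inj by (auto simp: inv_into_image_cancel perturbations_def)
    show "eventually (\<lambda>y. y \<in> alpha_star p ` S) (near (2 * p) \<alpha>)" if "\<alpha> \<in> alpha_star p ` S" for \<alpha>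
      using that nearV by blast
    fix \<alpha> j assume \<alpha>: "\<alpha> \<in> alpha_star p ` S" and j: "j \<in> {1..2 * p}"
    then obtain q where q: "q \<in> S" "\<alpha> = alpha_star p q" by blast
    have "eventually (\<lambda>y. the (run_alg y (inverse_alg p j)) = inv_into S (alpha_star p) y j) (near (2 * p) \<alpha>)"
      using nearV[OF q(1)] unfolding q(2)
    proof eventually_elim
      case (elim y)
      then obtain q' where "q' \<in> S" "y = alpha_star p q'" by blast
      thus ?case using run_inverse_alg[OF p _ j, of q'] S inv_into_f_f[OF inj] by auto
    qed
    thus "real_analytic_at (2 * p) \<alpha> (\<lambda>y. inv_into S (alpha_star p) y j)"
      using inverse_alg_analytic[OF p _ j, of q] S q by (auto intro: real_analytic_at_cong)
  qed
qed

theorem proposition1p2: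
  fixes p :: nat
  assumes "p \<ge> 1"
  shows "real_analytic_iso (2 * p) (X_space p)
           (E_space (2 * p) - alpha_star p ` X_degenerate p) (alpha_star p)
       \<and> real_analytic_iso (2 * p) (X_space p \<union> X_degenerate p)
           (E_space (2 * p)) (alpha_star p)
       \<and> (\<exists>alg :: nat \<Rightarrow> real_alg. \<forall>q\<in>X_space p. \<forall>i\<in>{1..2 * p}.
            run_alg (alpha_star p q) (alg i) = Some (q i))"
proof -
  let ?U = "perturbations p"
  note X = spaces_in_perturbations[OF assms]
  have im: "alpha_star p ` ?U = E_space (2 * p)"
  proof (intro equalityI subsetI)
    fix \<alpha> assume "\<alpha> \<in> E_space (2 * p)"
    then obtain q where "q \<in> ?U" "alpha_star p q = \<alpha>" by (rule alpha_star_surj[OF assms])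
    thus "\<alpha> \<in> alpha_star p ` ?U" by blast
  qed (auto intro: alpha_star_in_E_space[OF assms])
  have iso: "real_analytic_iso (2 * p) ?U (E_space (2 * p)) (alpha_star p)"
  proof -
    have "eventually (\<lambda>y. y \<in> alpha_star p ` ?U) (near (2 * p) (alpha_star p q))" if "q \<in> ?U" for q
      unfolding im by (rule near_E_space[OF alpha_star_in_E_space[OF assms that]])
    from alpha_star_iso[OF assms order_refl near_perturbations this] show ?thesis by (simp only: im)
  qed
  have nz: "eventually (\<lambda>y. y (2 * p - 1) \<noteq> 0 \<or> y (2 * p) \<noteq> 0) (near (2 * p) q)" if "q \<in> X_space p" for q
  proof -
    from that obtain i where i: "i = 2 * p - 1 \<or> i = 2 * p" "q i \<noteq> 0" unfolding X by auto
    have "q \<in> Rvec (2 * p)" using that by (simp add: X perturbations_def)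
    from real_analytic_at_near_neq[where f = "\<lambda>y. y i", OF real_analytic_at_coordinate this i(2)]
    show ?thesis by eventually_elim (use i(1) in auto)
  qed
  have "real_analytic_iso (2 * p) (X_space p) (alpha_star p ` X_space p) (alpha_star p)"
  proof (rule alpha_star_iso[OF assms])
    show "X_space p \<subseteq> ?U" by (auto simp: X)
    fix q assume q: "q \<in> X_space p"
    hence qU: "q \<in> ?U" by (simp add: X)
    show "eventually (\<lambda>y. y \<in> X_space p) (near (2 * p) q)"
      using near_perturbations[OF qU] nz[OF q] by eventually_elim (simp add: X)
    from q obtain i where i: "i = 2 * p - 1 \<or> i = 2 * p" "q i \<noteq> 0" unfolding X by auto
    have i': "i \<in> {1..2 * p}" using i assms by auto
    have "the (run_alg (alpha_star p q) (inverse_alg p i)) \<noteq> 0"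
      using run_inverse_alg[OF assms qU i'] i by simp
    (* Nearby spectral data come from perturbations whose coordinate i, computed by the algorithm,
       is still nonzero; so the image is open. *)
    from near_E_space[OF alpha_star_in_E_space[OF assms qU]]
      real_analytic_at_near_neq[OF inverse_alg_analytic[OF assms qU i'] alpha_star_Rvec this]
    show "eventually (\<lambda>y. y \<in> alpha_star p ` X_space p) (near (2 * p) (alpha_star p q))"
    proof eventually_elim
      case (elim y)
      then obtain q' where q': "q' \<in> ?U" "y = alpha_star p q'" using im by blast
      hence "q' i \<noteq> 0" using elim run_inverse_alg[OF assms q'(1) i'] by simp
      hence "q' \<in> X_space p" using q' i(1) by (auto simp: X)
      thus ?case using q' by blast
    qed
  qed
  moreover have "alpha_star p ` X_space p = E_space (2 * p) - alpha_star p ` X_degenerate p"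
  proof -
    have "X_space p = ?U - X_degenerate p" by (auto simp: X)
    thus ?thesis using inj_on_image_set_diff[OF alpha_star_inj[OF assms], of ?U "X_degenerate p"] im
      by (auto simp: X)
  qed
  moreover have "\<forall>q\<in>X_space p. \<forall>i\<in>{1..2 * p}. run_alg (alpha_star p q) (inverse_alg p i) = Some (q i)"
    using run_inverse_alg[OF assms] by (simp add: X(2))
  ultimately show ?thesis using iso unfolding X(1) by auto
qed

end
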